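(* Let $\lambda\in\mathbb{C}$ with $|\lambda|>1$, let $\varphi\in \mathrm{Diff}^\infty([0,\infty))$ be expanding, and let $R$ be the corresponding $3$-dimensional Reeb component with complex leaves given by the Hopf construction. Then the automorphism group $\mathrm{Aut}\,R\cong \mathrm{Aut}(\tilde R;T)/T^{\mathbb{Z}}$ is isomorphic to the semi-direct product $$\mathcal{K}_{\lambda,\varphi}\rtimes\left\{(\mathbb{C}^*\times Z_\varphi)/(\lambda,\varphi)^{\mathbb{Z}}\right\},$$ where $a\in\mathbb{C}^*$ acts on $b(x)\in\mathcal{K}_{\lambda,\varphi}$ by multiplication $b(x)\mapsto a^{-1}b(x)$ and $\eta\in Z_\varphi$ acts by $b(x)\mapsto b(\eta(x))$.
   Context: $\mathrm{Diff}^\infty([0,\infty))$ is the group of $C^\infty$ diffeomorphisms of the half line; $\varphi$ is called expanding if $\varphi(x)-x>0$ for all $x>0$ (and $\varphi(0)=0$). Hopf construction: let $\tilde R=\mathbb{C}\times[0,\infty)\setminus\{(0,0)\}$ with coordinates $(z,x)$, foliated by the leaves $\mathbb{C}\times\{x\}$ ($x>0$) and $\mathbb{C}^*\times\{0\}$, each with its natural complex structure. Let $T:\tilde R\to\tilde R$, $T(z,x)=(\lambda z,\varphi(x))$. The Reeb component is the quotient $R=\tilde R/T^{\mathbb{Z}}$ with the induced foliation and leafwise complex structure. $\mathrm{Aut}\,R$ (resp. $\mathrm{Aut}\,\tilde R$) is the group of all $C^\infty$ diffeomorphisms of $R$ (resp. $\tilde R$) which map leaves to leaves and are holomorphic on each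 leaf. $\mathrm{Aut}(\tilde R;T)$ is the centralizer of $T$ in $\mathrm{Aut}\,\tilde R$. $Z_\varphi$ is the centralizer of $\varphi$ in $\mathrm{Diff}^\infty([0,\infty))$. $\mathcal{K}_{\lambda,\varphi}$ is the additive group (complex vector space) of functions $b\in C^\infty([0,\infty);\mathbb{C})$ satisfying $b(\varphi(x))=\lambda b(x)$ for all $x\ge 0$; $b$ corresponds to the map $(z,x)\mapsto(z+b(x),x)$. $(\lambda,\varphi)^{\mathbb{Z}}$ is the subgroup of $\mathbb{C}^*\times Z_\varphi$ generated by $(\lambda,\varphi)$. *)

theory Defs
  imports
    "HOL-Analysis.Analysis"
    "HOL-Algebra.Bij"
    "HOL-Algebra.Coset"
    "HOL-Algebra.Generated_Groups"
begin

section \<open>Smooth maps on half-spaces\<close>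

text \<open>
  Derivatives are taken within the domain, so at a boundary point of a half-space they are
  one-sided.  The definition is used for relatively open subsets of
  \<open>[0,\<infinity>)\<close> and of \<open>\<complex> \<times> [0,\<infinity>)\<close> only; there derivatives within the set are unique, and by
  Whitney and Seeley the notion agrees with local extendability to smooth maps on open sets.
\<close>

primrec Ck_on :: "nat \<Rightarrow> 'a::euclidean_space set \<Rightarrow> ('a \<Rightarrow> 'b::real_normed_vector) \<Rightarrow> bool" where
  "Ck_on 0 S f \<longleftrightarrow> continuous_on S f"
| "Ck_on (Suc k) S f \<longleftrightarrow>
     (\<exists>f'. (\<forall>x\<in>S. (f has_derivative f' x) (at x within S)) \<and> (\<forall>v. Ck_on k S (\<lambda>x. f' x v)))"

definition smooth_on :: "'a::euclidean_space set \<Rightarrow> ('a \<Rightarrow> 'b::real_normed_vector) \<Rightarrow> bool" where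
  "smooth_on S f \<longleftrightarrow> (\<forall>k. Ck_on k S f)"

section \<open>Group constructions\<close>

definition centralizer_of :: "('g, 'm) monoid_scheme \<Rightarrow> 'g \<Rightarrow> ('g, 'm) monoid_scheme" where
  "centralizer_of G g = G\<lparr>carrier := {h \<in> carrier G. h \<otimes>\<^bsub>G\<^esub> g = g \<otimes>\<^bsub>G\<^esub> h}\<rparr>"

text \<open>
  The semi-direct product \<open>K \<rtimes> H\<close> for a right action \<open>act\<close> of \<open>H\<close> on \<open>K\<close>,
  \<open>act (h \<otimes> h') k = act h' (act h k)\<close>.  When \<open>K\<close> is a normal subgroup with complement \<open>H\<close>,
  the pair \<open>(k, h)\<close> stands for the product \<open>h k\<close>, and \<open>act h k\<close> for the conjugate \<open>h\<inverse> k h\<close>.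
\<close>

definition semidirect ::
  "('k, 'm) monoid_scheme \<Rightarrow> ('h, 'n) monoid_scheme \<Rightarrow> ('h \<Rightarrow> 'k \<Rightarrow> 'k) \<Rightarrow> ('k \<times> 'h) monoid" where
  "semidirect K H act =
     \<lparr>carrier = carrier K \<times> carrier H,
      mult = (\<lambda>(k, h) (k', h'). (act h' k \<otimes>\<^bsub>K\<^esub> k', h \<otimes>\<^bsub>H\<^esub> h')),
      one = (\<one>\<^bsub>K\<^esub>, \<one>\<^bsub>H\<^esub>)\<rparr>"

definition Cstar :: "complex monoid" where
  "Cstar = \<lparr>carrier = {a. a \<noteq> 0}, mult = (*), one = 1\<rparr>"

section \<open>Diffeomorphisms of the half line\<close>

text \<open>As in \<^const>\<open>BijGroup\<close>, maps are extensional and the product is composition.\<close>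

definition Diff_half :: "(real \<Rightarrow> real) monoid" where
  "Diff_half = BijGroup {0..}
     \<lparr>carrier := {f \<in> Bij {0..}. smooth_on {0..} f \<and> smooth_on {0..} (inv_into {0..} f)}\<rparr>"

definition expanding :: "(real \<Rightarrow> real) \<Rightarrow> bool" where
  "expanding \<phi> \<longleftrightarrow> \<phi> 0 = 0 \<and> (\<forall>x>0. \<phi> x - x > 0)"

section \<open>The covering space and its leafwise holomorphic automorphisms\<close>

definition Rt :: "(complex \<times> real) set" where
  "Rt = UNIV \<times> {0..} - {(0, 0)}"

definition leaf :: "real \<Rightarrow> (complex \<times> real) set" where
  "leaf x = (if x = 0 then (UNIV - {0}) \<times> {0} else UNIV \<times> {x})"

definition leaves_Rt :: "(complex \<times> real) set set" where
  "leaves_Rt = leaf ` {0..}"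

text \<open>
  For \<open>U\<close> relatively open in \<open>Rt\<close>, every slice of \<open>U\<close> at constant \<open>x\<close> is mapped holomorphically
  into a single slice.
\<close>

definition leafwise_holomorphic_on ::
  "(complex \<times> real) set \<Rightarrow> (complex \<times> real \<Rightarrow> complex \<times> real) \<Rightarrow> bool" where
  "leafwise_holomorphic_on U F \<longleftrightarrow>
     (\<forall>x. (\<exists>y. \<forall>z. (z, x) \<in> U \<longrightarrow> snd (F (z, x)) = y) \<and>
          (\<lambda>z. fst (F (z, x))) holomorphic_on {z. (z, x) \<in> U})"

definition Aut_Rt :: "(complex \<times> real \<Rightarrow> complex \<times> real) monoid" where
  "Aut_Rt = BijGroup Rt
     \<lparr>carrier := {F \<in> Bij Rt. smooth_on Rt F \<and> smooth_on Rt (inv_into Rt F) \<and>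
                   (\<forall>L\<in>leaves_Rt. F ` L \<in> leaves_Rt) \<and> leafwise_holomorphic_on Rt F}\<rparr>"

section \<open>The Hopf construction\<close>

definition hopf :: "complex \<Rightarrow> (real \<Rightarrow> real) \<Rightarrow> complex \<times> real \<Rightarrow> complex \<times> real" where
  "hopf lam \<phi> = restrict (\<lambda>(z, x). (lam * z, \<phi> x)) Rt"

definition proj :: "complex \<Rightarrow> (real \<Rightarrow> real) \<Rightarrow> complex \<times> real \<Rightarrow> (complex \<times> real) set" where
  "proj lam \<phi> p = {g p | g. g \<in> generate (BijGroup Rt) {hopf lam \<phi>}}"

definition Reeb :: "complex \<Rightarrow> (real \<Rightarrow> real) \<Rightarrow> (complex \<times> real) set set" where
  "Reeb lam \<phi> = proj lam \<phi> ` Rt"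

definition leaves_Reeb :: "complex \<Rightarrow> (real \<Rightarrow> real) \<Rightarrow> (complex \<times> real) set set set" where
  "leaves_Reeb lam \<phi> = (\<lambda>L. proj lam \<phi> ` L) ` leaves_Rt"

text \<open>
  The quotient carries the structure for which the projection is a local isomorphism: its
  (foliated) charts are the inverses of the projection on those open subsets of \<open>Rt\<close> where it is
  injective.  A chart is given here by that subset.
\<close>

definition Reeb_chart :: "complex \<Rightarrow> (real \<Rightarrow> real) \<Rightarrow> (complex \<times> real) set \<Rightarrow> bool" where
  "Reeb_chart lam \<phi> U \<longleftrightarrow> openin (top_of_set Rt) U \<and> inj_on (proj lam \<phi>) U"

definition in_charts ::
  "complex \<Rightarrow> (real \<Rightarrow> real) \<Rightarrow> (complex \<times> real) set \<Rightarrow>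
   ((complex \<times> real) set \<Rightarrow> (complex \<times> real) set) \<Rightarrow> complex \<times> real \<Rightarrow> complex \<times> real" where
  "in_charts lam \<phi> V F = (\<lambda>p. inv_into V (proj lam \<phi>) (F (proj lam \<phi> p)))"

definition locally_in_charts ::
  "complex \<Rightarrow> (real \<Rightarrow> real) \<Rightarrow>
   ((complex \<times> real) set \<Rightarrow> (complex \<times> real \<Rightarrow> complex \<times> real) \<Rightarrow> bool) \<Rightarrow>
   ((complex \<times> real) set \<Rightarrow> (complex \<times> real) set) \<Rightarrow> bool" where
  "locally_in_charts lam \<phi> P F \<longleftrightarrow>
     (\<forall>q\<in>Reeb lam \<phi>. \<exists>U V. Reeb_chart lam \<phi> U \<and> Reeb_chart lam \<phi> V \<and> q \<in> proj lam \<phi> ` U \<and>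
        F ` (proj lam \<phi> ` U) \<subseteq> proj lam \<phi> ` V \<and> P U (in_charts lam \<phi> V F))"

definition Aut_Reeb ::
  "complex \<Rightarrow> (real \<Rightarrow> real) \<Rightarrow> ((complex \<times> real) set \<Rightarrow> (complex \<times> real) set) monoid" where
  "Aut_Reeb lam \<phi> = BijGroup (Reeb lam \<phi>)
     \<lparr>carrier := {F \<in> Bij (Reeb lam \<phi>).
        locally_in_charts lam \<phi> smooth_on F \<and>
        locally_in_charts lam \<phi> smooth_on (inv_into (Reeb lam \<phi>) F) \<and>
        (\<forall>L\<in>leaves_Reeb lam \<phi>. F ` L \<in> leaves_Reeb lam \<phi>) \<and>
        locally_in_charts lam \<phi> leafwise_holomorphic_on F}\<rparr>"

section \<open>The factors of the semi-direct product\<close>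

definition Kgroup :: "complex \<Rightarrow> (real \<Rightarrow> real) \<Rightarrow> (real \<Rightarrow> complex) monoid" where
  "Kgroup lam \<phi> =
     \<lparr>carrier = {b \<in> extensional {0..}. smooth_on {0..} b \<and> (\<forall>x\<ge>0. b (\<phi> x) = lam * b x)},
      mult = (\<lambda>b c. \<lambda>x\<in>{0..}. b x + c x),
      one = (\<lambda>x\<in>{0..}. 0)\<rparr>"

definition Hgroup :: "complex \<Rightarrow> (real \<Rightarrow> real) \<Rightarrow> (complex \<times> (real \<Rightarrow> real)) set monoid" where
  "Hgroup lam \<phi> = (let G = Cstar \<times>\<times> centralizer_of Diff_half \<phi> in G Mod generate G {(lam, \<phi>)})"

text \<open>
  A coset acts on \<open>b\<close> through any of its representatives \<open>(a, \<eta>)\<close>, by \<open>b \<mapsto> a\<inverse> (b \<circ> \<eta>)\<close>.  On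
  \<open>Kgroup lam \<phi>\<close> the result does not depend on the representative, because
  \<open>b \<circ> \<phi> = lam * b\<close>.  Substituting \<open>\<eta>\<close> on the right makes this a right action.
\<close>

definition Kact :: "(complex \<times> (real \<Rightarrow> real)) set \<Rightarrow> (real \<Rightarrow> complex) \<Rightarrow> real \<Rightarrow> complex" where
  "Kact A b = (THE c. \<forall>(a, \<eta>)\<in>A. c = (\<lambda>x\<in>{0..}. inverse a * b (\<eta> x)))"

end

theory Submission
  imports Defs "HOL-Complex_Analysis.Cauchy_Integral_Formula"
begin

text \<open>
  The covering space \<open>Rt\<close> is star-shaped about \<open>(0, 1)\<close>, hence simply connected, so every
  automorphism of the Reeb component lifts to \<open>Rt\<close>, and two lifts differ by a power of the deck
  transformation \<open>T = hopf lam \<phi>\<close>.  A lift \<open>G\<close> satisfies \<open>G \<circ> T = T\<^sup>k \<circ> G\<close> with \<open>k = \<plusminus>1\<close>, and it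
  induces a homeomorphism of the leaf space \<open>[0, \<infinity>)\<close>, which is increasing; since \<open>\<phi>\<close> pushes every
  \<open>x > 0\<close> upwards, \<open>k = 1\<close>.  So \<open>G\<close> lies in the centralizer of \<open>T\<close>
  (\<open>ex_equivariant_lift\<close>).  Conversely the centralizer acts on the orbits of \<open>T\<close>, and only the powers
  of \<open>T\<close> act trivially.  This is the first isomorphism.

  For the second one the centralizer is computed (\<open>automorphism_structure\<close>).  Preservation of the
  leaves makes an element have the form \<open>(z, x) \<mapsto> (f (z, x), \<eta> x)\<close>; here \<open>\<eta>\<close> commutes with \<open>\<phi>\<close>, and
  \<open>f (lam * z, \<phi> x) = lam * f (z, x)\<close>.  On the compact set \<open>1 \<le> \<bar>z\<bar> \<le> \<bar>lam\<bar>\<close>, \<open>0 \<le> y \<le> x\<close> the function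
  \<open>f\<close> is bounded, and the functional equation spreads this bound to \<open>\<bar>f (z, x)\<bar> \<le> B * \<bar>z\<bar>\<close> for all
  \<open>\<bar>z\<bar> \<ge> 1\<close>.  By Liouville's theorem \<open>f\<close> is affine in \<open>z\<close> on every leaf with \<open>x > 0\<close>.  Moving such a
  leaf towards the boundary leaf by \<open>T\<^sup>-\<^sup>n\<close> keeps the linear coefficient and multiplies the constant
  term by \<open>lam\<^sup>-\<^sup>n\<close>, so in the limit all leaves have the linear coefficient \<open>a\<close> of the boundary leaf,
  on which the constant term is \<open>0\<close>.  Hence \<open>f (z, x) = a * (z + b x)\<close> with \<open>b\<close> in
  \<open>Kgroup lam \<phi>\<close>.

  Composition of the maps \<open>(z, x) \<mapsto> (a * (z + b x), \<eta> x)\<close> is the multiplication of the semi-direct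
  product of \<open>Kgroup lam \<phi>\<close> with the pairs \<open>(a, \<eta>)\<close>.  The deck transformation is the pair \<open>(lam, \<phi>)\<close>,
  which is central and acts trivially on \<open>Kgroup lam \<phi>\<close>; so dividing by it only changes the
  second factor (\<open>semidirect_quotient\<close>).
\<close>

section \<open>Calculus of smooth maps\<close>

lemma Ck_on_SucI:
  assumes "\<And>x. x \<in> S \<Longrightarrow> (f has_derivative f' x) (at x within S)" "\<And>v. Ck_on k S (\<lambda>x. f' x v)"
  shows "Ck_on (Suc k) S f"
  using assms by auto

lemma Ck_on_SucE:
  assumes "Ck_on (Suc k) S f"
  obtains f' where "\<And>x. x \<in> S \<Longrightarrow> (f has_derivative f' x) (at x within S)"
    "\<And>v. Ck_on k S (\<lambda>x. f' x v)"
  using assms by auto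

lemma Ck_on_cong:
  assumes "Ck_on k S f" "\<And>x. x \<in> S \<Longrightarrow> f x = g x"
  shows "Ck_on k S g"
proof (cases k)
  case 0
  then show ?thesis using assms by (simp cong: continuous_on_cong)
next
  case (Suc m)
  obtain f' where f': "\<And>x. x \<in> S \<Longrightarrow> (f has_derivative f' x) (at x within S)"
      "\<And>v. Ck_on m S (\<lambda>x. f' x v)"
    using assms(1) unfolding Suc by (rule Ck_on_SucE) blast
  show ?thesis unfolding Suc
  proof (rule Ck_on_SucI)
    show "(g has_derivative f' x) (at x within S)" if "x \<in> S" for x
      using f'(1)[OF that] assms(2) that by (metis has_derivative_transform)
  qed (rule f'(2))
qed

lemma Ck_on_subset: "Ck_on k S f \<Longrightarrow> U \<subseteq> S \<Longrightarrow> Ck_on k U f"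
proof (induction k arbitrary: f)
  case 0
  then show ?case by (auto intro: continuous_on_subset)
next
  case (Suc k)
  obtain f' where f': "\<And>x. x \<in> S \<Longrightarrow> (f has_derivative f' x) (at x within S)"
      "\<And>v. Ck_on k S (\<lambda>x. f' x v)"
    using Suc.prems(1) by (rule Ck_on_SucE) blast
  show ?case
  proof (rule Ck_on_SucI)
    show "(f has_derivative f' x) (at x within U)" if "x \<in> U" for x
      using f'(1) Suc.prems(2) that by (meson has_derivative_subset subsetD)
    show "Ck_on k U (\<lambda>x. f' x v)" for v
      by (rule Suc.IH[OF f'(2) Suc.prems(2)])
  qed
qed

lemma Ck_on_SucD: "Ck_on (Suc k) S f \<Longrightarrow> Ck_on k S f"
proof (induction k arbitrary: f)
  case 0
  then show ?case
    by (auto simp: continuous_on_eq_continuous_within intro: has_derivative_continuous)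
next
  case (Suc k)
  obtain f' where f': "\<And>x. x \<in> S \<Longrightarrow> (f has_derivative f' x) (at x within S)"
      "\<And>v. Ck_on (Suc k) S (\<lambda>x. f' x v)"
    using Suc.prems by (rule Ck_on_SucE) blast
  show ?case
    by (rule Ck_on_SucI[OF f'(1) Suc.IH[OF f'(2)]])
qed

lemma Ck_on_const [simp]: "Ck_on k S (\<lambda>x. c)"
proof (induction k arbitrary: c)
  case (Suc k)
  show ?case
    by (rule Ck_on_SucI[where f' = "\<lambda>x v. 0"]) (use Suc in auto)
qed simp

lemma Ck_on_linear_compose:
  assumes "bounded_linear h" "Ck_on k S f"
  shows "Ck_on k S (\<lambda>x. h (f x))"
  using assms(2)
proof (induction k arbitrary: f)
  case 0
  then show ?case
    using bounded_linear.continuous_on[OF assms(1)] by auto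
next
  case (Suc k)
  obtain f' where f': "\<And>x. x \<in> S \<Longrightarrow> (f has_derivative f' x) (at x within S)"
      "\<And>v. Ck_on k S (\<lambda>x. f' x v)"
    using Suc.prems by (rule Ck_on_SucE) blast
  show ?case
    by (rule Ck_on_SucI[where f' = "\<lambda>x v. h (f' x v)"])
      (simp_all add: f' Suc.IH bounded_linear.has_derivative[OF assms(1)])
qed

lemma Ck_on_ident: "Ck_on k S (\<lambda>x. x)"
  by (cases k) (auto intro!: exI[of _ "\<lambda>x v. v"])

lemma Ck_on_add:
  assumes "Ck_on k S f" "Ck_on k S g"
  shows "Ck_on k S (\<lambda>x. f x + g x)"
  using assms
proof (induction k arbitrary: f g)
  case 0
  then show ?case by (auto intro: continuous_on_add)
next
  case (Suc k)
  obtain f' where f': "\<And>x. x \<in> S \<Longrightarrow> (f has_derivative f' x) (at x within S)"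
      "\<And>v. Ck_on k S (\<lambda>x. f' x v)"
    using Suc.prems(1) by (rule Ck_on_SucE) blast
  obtain g' where g': "\<And>x. x \<in> S \<Longrightarrow> (g has_derivative g' x) (at x within S)"
      "\<And>v. Ck_on k S (\<lambda>x. g' x v)"
    using Suc.prems(2) by (rule Ck_on_SucE) blast
  show ?case
    by (rule Ck_on_SucI[where f' = "\<lambda>x v. f' x v + g' x v"])
      (simp_all add: f' g' Suc.IH has_derivative_add)
qed

lemma Ck_on_sum:
  "(\<And>i. i \<in> I \<Longrightarrow> Ck_on k S (f i)) \<Longrightarrow> Ck_on k S (\<lambda>x. \<Sum>i\<in>I. f i x)"
  by (induction I rule: infinite_finite_induct) (auto intro: Ck_on_add)

lemma Ck_on_scaleR:
  fixes f :: "_ \<Rightarrow> real"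
  assumes "Ck_on k S f" "Ck_on k S g"
  shows "Ck_on k S (\<lambda>x. f x *\<^sub>R g x)"
  using assms
proof (induction k arbitrary: f g)
  case 0
  then show ?case by (auto intro: continuous_on_scaleR)
next
  case (Suc k)
  obtain f' where f': "\<And>x. x \<in> S \<Longrightarrow> (f has_derivative f' x) (at x within S)"
      "\<And>v. Ck_on k S (\<lambda>x. f' x v)"
    using Suc.prems(1) by (rule Ck_on_SucE) blast
  obtain g' where g': "\<And>x. x \<in> S \<Longrightarrow> (g has_derivative g' x) (at x within S)"
      "\<And>v. Ck_on k S (\<lambda>x. g' x v)"
    using Suc.prems(2) by (rule Ck_on_SucE) blast
  show ?case
  proof (rule Ck_on_SucI)
    show "((\<lambda>x. f x *\<^sub>R g x) has_derivative (\<lambda>v. f x *\<^sub>R g' x v + f' x v *\<^sub>R g x)) (at x within S)"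
      if "x \<in> S" for x
      by (rule has_derivative_scaleR[OF f'(1)[OF that] g'(1)[OF that]])
    show "Ck_on k S (\<lambda>x. f x *\<^sub>R g' x v + f' x v *\<^sub>R g x)" for v
      by (intro Ck_on_add Suc.IH f'(2) g'(2) Suc.prems[THEN Ck_on_SucD])
  qed
qed

lemma Ck_on_Pair:
  assumes "Ck_on k S f" "Ck_on k S g"
  shows "Ck_on k S (\<lambda>x. (f x, g x))"
proof -
  have "Ck_on k S (\<lambda>x. (f x, 0) + (0, g x))"
    using assms
    by (intro Ck_on_add Ck_on_linear_compose[where h = "\<lambda>y. (y, 0)"]
        Ck_on_linear_compose[where h = "\<lambda>y. (0, y)"])
       (auto intro: bounded_linear_Pair bounded_linear_ident bounded_linear_zero)
  then show ?thesis by simp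
qed

text \<open>
  The recursion for \<open>Ck_on\<close> speaks of \<open>g' y v\<close> for a fixed direction \<open>v\<close>, whereas the chain rule
  produces \<open>g' (f x) (f' x v)\<close>.  Expanding \<open>f' x v\<close> in the basis of the intermediate space gives
  directional derivatives of \<open>g\<close> in fixed directions again, with smooth real coefficients.
\<close>
lemma Ck_on_compose:
  fixes f :: "'a::euclidean_space \<Rightarrow> 'b::euclidean_space"
  assumes "Ck_on k T g" "Ck_on k S f" "f ` S \<subseteq> T"
  shows "Ck_on k S (\<lambda>x. g (f x))"
  using assms(1,2)
proof (induction k arbitrary: g)
  case 0
  then show ?case
    using assms(3) by (auto intro: continuous_on_compose2)
next
  case (Suc k)
  obtain f' where f': "\<And>x. x \<in> S \<Longrightarrow> (f has_derivative f' x) (at x within S)"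
      "\<And>v. Ck_on k S (\<lambda>x. f' x v)"
    using Suc.prems(2) by (rule Ck_on_SucE) blast
  obtain g' where g': "\<And>y. y \<in> T \<Longrightarrow> (g has_derivative g' y) (at y within T)"
      "\<And>v. Ck_on k T (\<lambda>y. g' y v)"
    using Suc.prems(1) by (rule Ck_on_SucE) blast
  have "Ck_on k S f"
    by (rule Ck_on_SucD[OF Suc.prems(2)])
  then have "Ck_on k S (\<lambda>x. \<Sum>i\<in>Basis. (f' x v \<bullet> i) *\<^sub>R g' (f x) i)" for v
    by (intro Ck_on_sum Ck_on_scaleR Suc.IH g' f' Ck_on_linear_compose[OF bounded_linear_inner_left])
  moreover have "(\<Sum>i\<in>Basis. (f' x v \<bullet> i) *\<^sub>R g' (f x) i) = g' (f x) (f' x v)" if "x \<in> S" for x v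
  proof -
    have lin: "linear (g' (f x))"
      using g'(1) that assms(3) by (blast intro: has_derivative_linear)
    have "g' (f x) (f' x v) = g' (f x) (\<Sum>i\<in>Basis. (f' x v \<bullet> i) *\<^sub>R i)"
      by (simp add: euclidean_representation)
    then show ?thesis
      by (simp add: linear_sum[OF lin] linear_scale[OF lin])
  qed
  ultimately have "Ck_on k S (\<lambda>x. g' (f x) (f' x v))" for v
    by (rule Ck_on_cong)
  moreover have "((\<lambda>x. g (f x)) has_derivative (\<lambda>v. g' (f x) (f' x v))) (at x within S)"
    if "x \<in> S" for x
  proof -
    have "(g has_derivative g' (f x)) (at (f x) within f ` S)"
      using g'(1) that assms(3) by (meson has_derivative_subset image_subset_iff)
    with f'(1)[OF that] show ?thesis
      by (rule has_derivative_in_compose)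
  qed
  ultimately show ?case by (intro Ck_on_SucI)
qed

text \<open>
  The pieces \<open>f'\<close> of the derivative given on the neighbourhoods fit together
  because derivatives within \<open>S\<close> are unique.
\<close>
lemma Ck_on_local:
  assumes unique: "\<And>x i e. x \<in> S \<Longrightarrow> i \<in> Basis \<Longrightarrow> 0 < e \<Longrightarrow> \<exists>d. 0 < \<bar>d\<bar> \<and> \<bar>d\<bar> < e \<and> x + d *\<^sub>R i \<in> S"
    and local: "\<And>x. x \<in> S \<Longrightarrow> \<exists>U. openin (top_of_set S) U \<and> x \<in> U \<and> Ck_on k U f"
  shows "Ck_on k S f"
  using local
proof (induction k arbitrary: f)
  case 0
  show ?case unfolding Ck_on.simps continuous_on_eq_continuous_within
  proof
    fix x assume "x \<in> S"
    then obtain U where U: "openin (top_of_set S) U" "x \<in> U" "continuous_on U f"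
      using 0 by auto
    then obtain W where W: "open W" "U = S \<inter> W"
      by (auto simp: openin_open)
    have "at x within S = at x within U"
      using U(2) W by (auto intro!: at_within_nhd[of _ W])
    with U show "continuous (at x within S) f"
      by (simp add: continuous_on_eq_continuous_within)
  qed
next
  case (Suc k)
  have "\<exists>U f'. openin (top_of_set S) U \<and> x \<in> U \<and> (\<forall>y\<in>U. (f has_derivative f' y) (at y within S))
          \<and> (\<forall>v. Ck_on k U (\<lambda>y. f' y v))" if x: "x \<in> S" for x
  proof -
    obtain U where U: "openin (top_of_set S) U" "x \<in> U" "Ck_on (Suc k) U f"
      using Suc.prems[OF x] by auto
    obtain f' where f': "\<And>y. y \<in> U \<Longrightarrow> (f has_derivative f' y) (at y within U)"
      "\<And>v. Ck_on k U (\<lambda>y. f' y v)"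
      using U(3) by (rule Ck_on_SucE) blast
    obtain W where W: "open W" "U = S \<inter> W"
      using U by (auto simp: openin_open)
    then have "at y within S = at y within U" if "y \<in> U" for y
      using that by (auto intro!: at_within_nhd[of _ W])
    with f' U show ?thesis by metis
  qed
  then obtain U f' where U: "\<And>x. x \<in> S \<Longrightarrow> openin (top_of_set S) (U x)" "\<And>x. x \<in> S \<Longrightarrow> x \<in> U x"
    and f': "\<And>x y. x \<in> S \<Longrightarrow> y \<in> U x \<Longrightarrow> (f has_derivative f' x y) (at y within S)"
    and Ck: "\<And>x v. x \<in> S \<Longrightarrow> Ck_on k (U x) (\<lambda>y. f' x y v)"
    by metis
  show ?case
  proof (rule Ck_on_SucI)
    show "(f has_derivative f' x x) (at x within S)" if "x \<in> S" for x
      using f' U that by blast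
    have "Ck_on k (U x) (\<lambda>y. f' y y v)" if x: "x \<in> S" for x v
    proof (rule Ck_on_cong[OF Ck[OF x]])
      fix y assume y: "y \<in> U x"
      then have "y \<in> S"
        using U(1)[OF x] openin_imp_subset by blast
      then have "f' x y = f' y y"
        using frechet_derivative_unique_within[OF f'[OF x y] f'[OF _ U(2)] unique] by blast
      then show "f' x y v = f' y y v"
        by simp
    qed
    then show "Ck_on k S (\<lambda>x. f' x x v)" for v
      using U by (intro Suc.IH) blast
  qed
qed

subsection \<open>Smooth maps\<close>

lemma smooth_on_cong:
  "smooth_on S f \<Longrightarrow> (\<And>x. x \<in> S \<Longrightarrow> f x = g x) \<Longrightarrow> smooth_on S g"
  unfolding smooth_on_def by (metis Ck_on_cong)

lemma smooth_on_subset: "smooth_on S f \<Longrightarrow> U \<subseteq> S \<Longrightarrow> smooth_on U f"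
  unfolding smooth_on_def by (metis Ck_on_subset)

lemma smooth_on_imp_continuous_on: "smooth_on S f \<Longrightarrow> continuous_on S f"
  unfolding smooth_on_def by (metis Ck_on.simps(1))

lemma smooth_on_const [simp]: "smooth_on S (\<lambda>x. c)"
  unfolding smooth_on_def by simp

lemma smooth_on_ident: "smooth_on S (\<lambda>x. x)"
  unfolding smooth_on_def by (simp add: Ck_on_ident)

lemma smooth_on_linear_compose:
  "bounded_linear h \<Longrightarrow> smooth_on S f \<Longrightarrow> smooth_on S (\<lambda>x. h (f x))"
  unfolding smooth_on_def by (metis Ck_on_linear_compose)

lemma smooth_on_linear: "bounded_linear h \<Longrightarrow> smooth_on S h"
  by (rule smooth_on_linear_compose[OF _ smooth_on_ident])

lemma smooth_on_add:
  "smooth_on S f \<Longrightarrow> smooth_on S g \<Longrightarrow> smooth_on S (\<lambda>x. f x + g x)"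
  unfolding smooth_on_def by (metis Ck_on_add)

lemma smooth_on_Pair:
  "smooth_on S f \<Longrightarrow> smooth_on S g \<Longrightarrow> smooth_on S (\<lambda>x. (f x, g x))"
  unfolding smooth_on_def by (metis Ck_on_Pair)

lemma smooth_on_compose:
  fixes f :: "'a::euclidean_space \<Rightarrow> 'b::euclidean_space"
  shows "smooth_on T g \<Longrightarrow> smooth_on S f \<Longrightarrow> f ` S \<subseteq> T \<Longrightarrow> smooth_on S (\<lambda>x. g (f x))"
  unfolding smooth_on_def by (metis Ck_on_compose)

lemma smooth_on_local:
  assumes "\<And>x i e. x \<in> S \<Longrightarrow> i \<in> Basis \<Longrightarrow> 0 < e \<Longrightarrow> \<exists>d. 0 < \<bar>d\<bar> \<and> \<bar>d\<bar> < e \<and> x + d *\<^sub>R i \<in> S"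
    and "\<And>x. x \<in> S \<Longrightarrow> \<exists>U. openin (top_of_set S) U \<and> x \<in> U \<and> smooth_on U f"
  shows "smooth_on S f"
  unfolding smooth_on_def
proof
  show "Ck_on k S f" for k
  proof (rule Ck_on_local[OF assms(1)])
    fix x assume "x \<in> S"
    then show "\<exists>U. openin (top_of_set S) U \<and> x \<in> U \<and> Ck_on k U f"
      using assms(2) unfolding smooth_on_def by meson
  qed
qed

section \<open>Groups\<close>

text \<open>
  For the cyclic groups generated by the deck transformation and by \<open>(lam, \<phi>)\<close>, the powers are
  given by explicit formulas.
\<close>
lemma (in group) generate_one_parameter:
  fixes f :: "int \<Rightarrow> 'a"
  assumes closed: "\<And>n. f n \<in> carrier G" and add: "\<And>m n. f (m + n) = f m \<otimes> f n"
  shows "generate G {f 1} = range f"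
proof -
  have zero: "f 0 = \<one>"
    using add[of 0 0] closed by (metis add_0 r_cancel_one)
  have "f n = f 1 [^] n" for n
  proof (induction n rule: int_induct[where k = 0])
    case base
    then show ?case by (simp add: zero)
  next
    case (step1 i)
    then show ?case
      using add[of i 1] closed by (simp add: int_pow_mult)
  next
    case (step2 i)
    have "f (i - 1) \<otimes> f 1 = f 1 [^] (i - 1) \<otimes> f 1"
      using add[of "i - 1" 1] step2 closed int_pow_mult[of "f 1" "i - 1" 1] by simp
    then show ?case
      using closed by (simp add: int_pow_closed)
  qed
  then have "range f = range (\<lambda>n::int. f 1 [^] n)"
    by (rule image_cong[OF refl])
  then show ?thesis
    unfolding generate_pow[OF closed[of 1]] by blast
qed

lemma (in group) generate_central_normal:
  assumes "t \<in> carrier G" "\<And>g. g \<in> carrier G \<Longrightarrow> g \<otimes> t = t \<otimes> g"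
  shows "generate G {t} \<lhd> G"
  using assms by (intro normal_generateI) (auto simp: m_assoc)

lemma (in group) centralizer_subgroup:
  assumes "g \<in> carrier G"
  shows "subgroup {h \<in> carrier G. h \<otimes> g = g \<otimes> h} G"
proof (rule subgroupI)
  fix h assume "h \<in> {h \<in> carrier G. h \<otimes> g = g \<otimes> h}"
  then have h: "h \<in> carrier G" "h \<otimes> g = g \<otimes> h" by auto
  have "inv h \<otimes> g = inv h \<otimes> (g \<otimes> h) \<otimes> inv h"
    using h(1) assms by (simp add: m_assoc)
  also have "\<dots> = g \<otimes> inv h"
    unfolding h(2)[symmetric] using h(1) assms by (simp add: m_assoc[symmetric])
  finally show "inv h \<in> {h \<in> carrier G. h \<otimes> g = g \<otimes> h}"
    using h by simp
next
  fix h k assume "h \<in> {h \<in> carrier G. h \<otimes> g = g \<otimes> h}" "k \<in> {h \<in> carrier G. h \<otimes> g = g \<otimes> h}"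
  then show "h \<otimes> k \<in> {h \<in> carrier G. h \<otimes> g = g \<otimes> h}"
    using assms by (auto simp: m_assoc) (metis m_assoc)
qed (use assms in \<open>auto intro: one_closed\<close>)

lemma (in group) centralizer_iff:
  "h \<in> carrier (centralizer_of G g) \<longleftrightarrow> h \<in> carrier G \<and> h \<otimes> g = g \<otimes> h"
  by (simp add: centralizer_of_def)

lemma (in group) centralizer_group: "g \<in> carrier G \<Longrightarrow> group (centralizer_of G g)"
  unfolding centralizer_of_def by (rule subgroup_imp_group[OF centralizer_subgroup])

lemma iso_sym_of_quotient:
  assumes "group_hom G A f" "f ` carrier G = carrier A" "kernel G A f = N"
  shows "A \<cong> G Mod N"
proof -
  interpret group_hom G A f by (rule assms)
  have "group (G Mod N)"
    using normal_kernel assms(3) normal.factorgroup_is_group by blast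
  with FactGroup_iso assms show ?thesis
    using group.iso_sym by blast
qed

lemma Cstar_group: "group Cstar"
proof (rule groupI)
  fix a assume "a \<in> carrier Cstar"
  then show "\<exists>b\<in>carrier Cstar. b \<otimes>\<^bsub>Cstar\<^esub> a = \<one>\<^bsub>Cstar\<^esub>"
    by (intro bexI[of _ "inverse a"]) (auto simp: Cstar_def)
qed (auto simp: Cstar_def)

subsection \<open>Semi-direct products\<close>

locale right_action = K: group K + H: group H
  for K :: "('k, 'm) monoid_scheme" (structure) and H :: "('h, 'n) monoid_scheme" (structure) +
  fixes act :: "'h \<Rightarrow> 'k \<Rightarrow> 'k"
  assumes act_closed: "h \<in> carrier H \<Longrightarrow> k \<in> carrier K \<Longrightarrow> act h k \<in> carrier K"
    and act_mult: "h \<in> carrier H \<Longrightarrow> k \<in> carrier K \<Longrightarrow> k' \<in> carrier K \<Longrightarrow>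
          act h (k \<otimes>\<^bsub>K\<^esub> k') = act h k \<otimes>\<^bsub>K\<^esub> act h k'"
    and act_one: "k \<in> carrier K \<Longrightarrow> act \<one>\<^bsub>H\<^esub> k = k"
    and act_act: "h \<in> carrier H \<Longrightarrow> h' \<in> carrier H \<Longrightarrow> k \<in> carrier K \<Longrightarrow>
          act (h \<otimes>\<^bsub>H\<^esub> h') k = act h' (act h k)"
begin

lemma act_neutral: "h \<in> carrier H \<Longrightarrow> act h \<one>\<^bsub>K\<^esub> = \<one>\<^bsub>K\<^esub>"
proof -
  assume h: "h \<in> carrier H"
  have c: "act h \<one>\<^bsub>K\<^esub> \<in> carrier K"
    by (rule act_closed[OF h K.one_closed])
  have "act h \<one>\<^bsub>K\<^esub> \<otimes>\<^bsub>K\<^esub> act h \<one>\<^bsub>K\<^esub> = act h \<one>\<^bsub>K\<^esub>"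
    using act_mult[OF h K.one_closed K.one_closed] by simp
  then show "act h \<one>\<^bsub>K\<^esub> = \<one>\<^bsub>K\<^esub>"
    using c K.l_cancel_one by blast
qed

lemma semidirect_group: "group (semidirect K H act)"
proof (rule groupI)
  fix p assume "p \<in> carrier (semidirect K H act)"
  then obtain k h where p: "p = (k, h)" "k \<in> carrier K" "h \<in> carrier H"
    by (auto simp: semidirect_def)
  let ?q = "(act (inv\<^bsub>H\<^esub> h) (inv\<^bsub>K\<^esub> k), inv\<^bsub>H\<^esub> h)"
  have "act h (act (inv\<^bsub>H\<^esub> h) (inv\<^bsub>K\<^esub> k)) = inv\<^bsub>K\<^esub> k"
    using p act_act[of "inv\<^bsub>H\<^esub> h" h "inv\<^bsub>K\<^esub> k"] act_one by simp
  then have "?q \<otimes>\<^bsub>semidirect K H act\<^esub> p = \<one>\<^bsub>semidirect K H act\<^esub>"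
    using p by (simp add: semidirect_def)
  moreover have "?q \<in> carrier (semidirect K H act)"
    using p act_closed by (simp add: semidirect_def)
  ultimately show "\<exists>q\<in>carrier (semidirect K H act).
      q \<otimes>\<^bsub>semidirect K H act\<^esub> p = \<one>\<^bsub>semidirect K H act\<^esub>"
    by blast
qed (auto simp: semidirect_def act_closed act_mult act_act act_neutral act_one
    K.m_assoc H.m_assoc)

text \<open>
  A normal subgroup \<open>N\<close> of \<open>H\<close> that acts trivially on \<open>K\<close> can be divided out in the second factor
  alone.
\<close>
lemma semidirect_quotient:
  assumes N: "N \<lhd> H"
    and act': "\<And>h k. h \<in> carrier H \<Longrightarrow> k \<in> carrier K \<Longrightarrow> act' (N #>\<^bsub>H\<^esub> h) k = act h k"
  defines "q \<equiv> \<lambda>(k, h). (k, N #>\<^bsub>H\<^esub> h)"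
  shows "group_hom (semidirect K H act) (semidirect K (H Mod N) act') q"
    and "q ` carrier (semidirect K H act) = carrier (semidirect K (H Mod N) act')"
    and "kernel (semidirect K H act) (semidirect K (H Mod N) act') q = {\<one>\<^bsub>K\<^esub>} \<times> N"
proof -
  interpret N: normal N H by (rule N)
  have mult: "(N #>\<^bsub>H\<^esub> h) <#>\<^bsub>H\<^esub> (N #>\<^bsub>H\<^esub> h') = N #>\<^bsub>H\<^esub> (h \<otimes>\<^bsub>H\<^esub> h')"
    if "h \<in> carrier H" "h' \<in> carrier H" for h h'
    using that by (rule N.rcos_sum)
  have one: "N = N #>\<^bsub>H\<^esub> \<one>\<^bsub>H\<^esub>"
    by (simp add: N.subset)
  interpret Q: right_action K "H Mod N" act'
  proof (intro right_action.intro right_action_axioms.intro K.group_axioms N.factorgroup_is_group)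
    show "act' \<one>\<^bsub>H Mod N\<^esub> k = k" if "k \<in> carrier K" for k
      using that act'[of "\<one>\<^bsub>H\<^esub>" k] act_one one by simp
  qed (auto simp: carrier_FactGroup act' act_closed act_mult act_act mult)
  have group: "group (semidirect K H act)" "group (semidirect K (H Mod N) act')"
    by (rule semidirect_group, rule Q.semidirect_group)
  show "group_hom (semidirect K H act) (semidirect K (H Mod N) act') q"
    using group
    by (auto simp: group_hom_def group_hom_axioms_def hom_def semidirect_def q_def
        carrier_FactGroup act' mult)
  show "q ` carrier (semidirect K H act) = carrier (semidirect K (H Mod N) act')"
    by (auto simp: semidirect_def q_def carrier_FactGroup image_iff)
  have "N #>\<^bsub>H\<^esub> h = N \<longleftrightarrow> h \<in> N" if "h \<in> carrier H" for h
    using that by (metis H.coset_join1 H.coset_join2 N.subset N.subgroup_axioms)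
  then show "kernel (semidirect K H act) (semidirect K (H Mod N) act') q = {\<one>\<^bsub>K\<^esub>} \<times> N"
    using N.subset by (auto simp: kernel_def semidirect_def q_def)
qed

end

subsection \<open>Groups of bijections\<close>

lemma BijGroup_simps:
  "carrier (BijGroup S) = Bij S" "\<one>\<^bsub>BijGroup S\<^esub> = (\<lambda>x\<in>S. x)"
  "f \<in> Bij S \<Longrightarrow> g \<in> Bij S \<Longrightarrow> f \<otimes>\<^bsub>BijGroup S\<^esub> g = (\<lambda>x\<in>S. f (g x))"
  by (auto simp: BijGroup_def compose_def)

lemma Bij_restrictI:
  assumes "\<And>x. x \<in> S \<Longrightarrow> f x \<in> S" "\<And>x. x \<in> S \<Longrightarrow> g x \<in> S"
    "\<And>x. x \<in> S \<Longrightarrow> g (f x) = x" "\<And>x. x \<in> S \<Longrightarrow> f (g x) = x"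
  shows "restrict f S \<in> Bij S"
  unfolding Bij_def using assms
  by (auto intro!: bij_betw_byWitness[where f' = g])

lemma inv_into_restrict_eq:
  assumes "\<And>x. x \<in> S \<Longrightarrow> f x \<in> S" "\<And>x. x \<in> S \<Longrightarrow> g x \<in> S"
    "\<And>x. x \<in> S \<Longrightarrow> g (f x) = x" "\<And>x. x \<in> S \<Longrightarrow> f (g x) = x" "y \<in> S"
  shows "inv_into S (restrict f S) y = g y"
proof (rule inv_into_f_eq)
  show "inj_on (restrict f S) S"
    using assms by (auto intro!: inj_on_inverseI[where g = g])
qed (use assms in auto)

lemma Bij_app: "f \<in> Bij S \<Longrightarrow> x \<in> S \<Longrightarrow> f x \<in> S"
  using Bij_imp_funcset by blast

lemma Bij_inv_into:
  assumes "f \<in> Bij S" "x \<in> S"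
  shows "inv_into S f x \<in> S" "f (inv_into S f x) = x" "inv_into S f (f x) = x"
  using assms by (auto simp: Bij_def bij_betw_def f_inv_into_f inv_into_into)

section \<open>Diffeomorphisms of the half line\<close>

lemma Diff_half_iff:
  "f \<in> carrier Diff_half \<longleftrightarrow>
     f \<in> Bij {0..} \<and> smooth_on {0..} f \<and> smooth_on {0..} (inv_into {0..} f)"
  by (simp add: Diff_half_def)

lemma Diff_half_subgroup: "subgroup (carrier Diff_half) (BijGroup {0..})"
proof -
  interpret B: group "BijGroup {0::real..}" by (rule group_BijGroup)
  show ?thesis
  proof (rule B.subgroupI)
    show "carrier Diff_half \<subseteq> carrier (BijGroup {0..})"
      by (auto simp: Diff_half_iff BijGroup_simps)
    have "(\<lambda>x\<in>{0::real..}. x) \<in> carrier Diff_half"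
      unfolding Diff_half_iff
    proof (intro conjI)
      show "smooth_on {0::real..} (\<lambda>x\<in>{0..}. x)"
        by (rule smooth_on_cong[OF smooth_on_ident]) auto
      show "smooth_on {0::real..} (inv_into {0..} (\<lambda>x\<in>{0..}. x))"
        by (rule smooth_on_cong[OF smooth_on_ident])
          (rule inv_into_restrict_eq[of _ "\<lambda>x. x" "\<lambda>x. x", symmetric]; simp)
    qed (rule id_Bij)
    then show "carrier Diff_half \<noteq> {}" by blast
  next
    fix f assume f: "f \<in> carrier Diff_half"
    then have fB: "f \<in> Bij {0..}" by (simp add: Diff_half_iff)
    have "smooth_on {0..} (inv_into {0..} (\<lambda>x\<in>{0..}. inv_into {0..} f x))"
    proof (rule smooth_on_cong)
      show "smooth_on {0..} f" using f by (simp add: Diff_half_iff)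
      show "f x = inv_into {0..} (\<lambda>x\<in>{0..}. inv_into {0..} f x) x" if "x \<in> {0..}" for x
        by (rule inv_into_restrict_eq[symmetric]) (use that Bij_inv_into[OF fB] Bij_app[OF fB] in auto)
    qed
    moreover have "smooth_on {0..} (\<lambda>x\<in>{0..}. inv_into {0..} f x)"
      using f by (auto simp: Diff_half_iff intro: smooth_on_cong)
    ultimately show "inv\<^bsub>BijGroup {0..}\<^esub> f \<in> carrier Diff_half"
      using fB by (simp add: inv_BijGroup Diff_half_iff restrict_inv_into_Bij)
  next
    fix f g assume f: "f \<in> carrier Diff_half" and g: "g \<in> carrier Diff_half"
    then have fB: "f \<in> Bij {0..}" and gB: "g \<in> Bij {0..}" by (auto simp: Diff_half_iff)
    have "smooth_on {0..} (\<lambda>x\<in>{0..}. f (g x))"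
    proof (rule smooth_on_cong)
      show "smooth_on {0..} (\<lambda>x. f (g x))"
        using f g Bij_app[OF gB] by (auto simp: Diff_half_iff intro: smooth_on_compose[of "{0..}" f "{0..}" g])
    qed simp
    moreover have "smooth_on {0..} (inv_into {0..} (\<lambda>x\<in>{0..}. f (g x)))"
    proof (rule smooth_on_cong)
      show "smooth_on {0..} (\<lambda>x. inv_into {0..} g (inv_into {0..} f x))"
        using f g Bij_inv_into(1)[OF fB]
        by (auto simp: Diff_half_iff
            intro: smooth_on_compose[of "{0..}" "inv_into {0..} g" "{0..}" "inv_into {0..} f"])
      show "inv_into {0..} g (inv_into {0..} f x) = inv_into {0..} (\<lambda>x\<in>{0..}. f (g x)) x"
        if "x \<in> {0..}" for x
        by (rule inv_into_restrict_eq[symmetric])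
          (use that Bij_inv_into[OF fB] Bij_app[OF fB] Bij_inv_into[OF gB] Bij_app[OF gB] in auto)
    qed
    moreover have "(\<lambda>x\<in>{0..}. f (g x)) \<in> Bij {0..}"
      using compose_Bij[OF fB gB] by (simp add: compose_def)
    ultimately show "f \<otimes>\<^bsub>BijGroup {0..}\<^esub> g \<in> carrier Diff_half"
      using fB gB by (simp add: BijGroup_simps Diff_half_iff)
  qed
qed

lemma Diff_half_alt: "Diff_half = BijGroup {0..}\<lparr>carrier := carrier Diff_half\<rparr>"
  by (simp add: Diff_half_def)

lemma Diff_half_group: "group Diff_half"
  by (subst Diff_half_alt) (rule group.subgroup_imp_group[OF group_BijGroup Diff_half_subgroup])

lemma Diff_half_one: "\<one>\<^bsub>Diff_half\<^esub> = (\<lambda>x\<in>{0..}. x)"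
  by (simp add: Diff_half_def BijGroup_def)

lemma Diff_half_mult:
  "f \<in> carrier Diff_half \<Longrightarrow> g \<in> carrier Diff_half \<Longrightarrow> f \<otimes>\<^bsub>Diff_half\<^esub> g = (\<lambda>x\<in>{0..}. f (g x))"
  by (simp add: Diff_half_def BijGroup_def compose_def)

text \<open>
  A continuous injection is strictly monotone, and it cannot decrease because its value at \<open>0\<close> is
  its minimum.
\<close>
lemma half_line_strict_mono:
  fixes f :: "real \<Rightarrow> real"
  assumes cont: "continuous_on {0..} f" and inj: "inj_on f {0..}" and zero: "f 0 = 0"
    and nonneg: "\<And>x. 0 \<le> x \<Longrightarrow> 0 \<le> f x" and xy: "0 \<le> x" "x < y"
  shows "f x < f y"
proof (cases "x = 0")
  case True
  have "f y \<noteq> f 0" using inj_onD[OF inj, of y 0] xy True by auto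
  with nonneg[of y] xy True show ?thesis by (simp add: zero)
next
  case False
  have "continuous_on {0..y} f"
    by (rule continuous_on_subset[OF cont]) auto
  moreover have "inj_on f {0..y}"
    by (rule inj_on_subset[OF inj]) auto
  ultimately have "(f 0 < f x \<and> f x < f y) \<or> (f y < f x \<and> f x < f 0)"
    using xy False by (intro continuous_inj_imp_mono) auto
  with nonneg[of x] xy show ?thesis by (auto simp: zero)
qed

section \<open>The Hopf construction\<close>

lemma Rt_iff: "(z, x) \<in> Rt \<longleftrightarrow> 0 \<le> x \<and> (x = 0 \<longrightarrow> z \<noteq> 0)"
  by (auto simp: Rt_def)

text \<open>
  A segment that starts at \<open>(0, 1)\<close> can reach height \<open>0\<close> only at its other endpoint, so it avoids the
  origin if that endpoint does.
\<close>
lemma starlike_Rt: "starlike Rt"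
proof -
  have "closed_segment (0, 1) p \<subseteq> Rt" if p: "p \<in> Rt" for p
  proof
    fix q assume "q \<in> closed_segment (0, 1) p"
    then obtain u where u: "0 \<le> u" "u \<le> 1" "q = (1 - u) *\<^sub>R (0, 1) + u *\<^sub>R p"
      by (auto simp: closed_segment_def)
    obtain z x where zx: "p = (z, x)" by (cases p)
    have x: "0 \<le> x" "x = 0 \<Longrightarrow> z \<noteq> 0" using p zx by (auto simp: Rt_iff)
    have q: "q = (u *\<^sub>R z, (1 - u) + u * x)" using u zx by simp
    have "u *\<^sub>R z \<noteq> 0" if "(1 - u) + u * x = 0"
    proof -
      have "1 - u = 0 \<and> u * x = 0"
        using u x that by (smt (verit) mult_nonneg_nonneg)
      then show ?thesis using x by auto
    qed
    moreover have "0 \<le> (1 - u) + u * x"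
      using u x by simp
    ultimately show "q \<in> Rt"
      unfolding q Rt_iff by blast
  qed
  then show ?thesis
    unfolding starlike_def by (intro bexI[of _ "(0, 1)"]) (auto simp: Rt_iff)
qed

lemma connected_Rt: "connected Rt"
  by (rule starlike_imp_connected[OF starlike_Rt])

lemma locally_path_connected_Rt: "locally path_connected Rt"
proof (rule locally_open_subset)
  show "locally path_connected (UNIV \<times> {0..} :: (complex \<times> real) set)"
    by (intro convex_imp_locally_path_connected convex_Times) auto
  show "openin (top_of_set (UNIV \<times> {0..})) Rt"
    unfolding Rt_def openin_open by (intro exI[of _ "- {(0, 0)}"]) auto
qed

text \<open>
  This is the condition under which local smoothness implies smoothness (\<open>smooth_on_local\<close>).
  A step in the direction of \<open>x\<close> is taken upwards, and a step in a direction of \<open>z\<close> is made shorter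
  than \<open>\<bar>z\<bar>\<close>, which keeps it away from the missing origin.
\<close>
lemma Rt_unique_derivatives:
  assumes "p \<in> Rt" "i \<in> Basis" "0 < e"
  shows "\<exists>d. 0 < \<bar>d\<bar> \<and> \<bar>d\<bar> < e \<and> p + d *\<^sub>R i \<in> Rt"
proof -
  obtain z x where p: "p = (z, x)" by (cases p)
  have px: "0 \<le> x" "x = 0 \<Longrightarrow> z \<noteq> 0" using assms(1) p by (auto simp: Rt_iff)
  show ?thesis
  proof (cases "i = (0, 1)")
    case True
    then show ?thesis
      using assms(3) px by (intro exI[of _ "e / 2"]) (auto simp: p Rt_iff)
  next
    case False
    then obtain j where j: "i = (j, 0)" "j \<in> Basis"
      using assms(2) by (auto simp: Basis_prod_def)
    then have "norm j = 1" by (simp add: norm_Basis)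
    define d where "d = (if norm z = 0 then e / 2 else min (e / 2) (norm z / 2))"
    have d: "0 < d" "d < e" "z \<noteq> 0 \<Longrightarrow> d < norm z"
      using assms(3) by (auto simp: d_def min_def)
    have "z + d *\<^sub>R j \<noteq> 0" if "z \<noteq> 0"
    proof
      assume "z + d *\<^sub>R j = 0"
      then have "norm z = norm (d *\<^sub>R j)" by (metis add_eq_0_iff norm_minus_cancel)
      with d(1) d(3)[OF that] \<open>norm j = 1\<close> show False by simp
    qed
    then show ?thesis
      using d px by (intro exI[of _ d]) (auto simp: p j Rt_iff)
  qed
qed

locale hopf_construction =
  fixes lam :: complex and \<phi> :: "real \<Rightarrow> real"
  assumes norm_lam: "norm lam > 1"
    and phi: "\<phi> \<in> carrier Diff_half"
    and expanding: "expanding \<phi>"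
begin

sublocale D: group Diff_half by (rule Diff_half_group)

abbreviation Z where "Z \<equiv> centralizer_of Diff_half \<phi>"

sublocale Z: group Z by (rule D.centralizer_group[OF phi])

definition phi_pow :: "int \<Rightarrow> real \<Rightarrow> real" where
  "phi_pow n = \<phi> [^]\<^bsub>Diff_half\<^esub> n"

definition deck :: "int \<Rightarrow> complex \<times> real \<Rightarrow> complex \<times> real" where
  "deck n = (\<lambda>(z, x). (lam powi n * z, phi_pow n x))"

lemma lam_nonzero [simp]: "lam \<noteq> 0"
  using norm_lam by auto

lemma phi_0 [simp]: "\<phi> 0 = 0"
  using expanding by (simp add: expanding_def)

lemma phi_gt: "0 < x \<Longrightarrow> x < \<phi> x"
  using expanding by (simp add: expanding_def)

lemma Z_iff:
  "\<eta> \<in> carrier Z \<longleftrightarrow> \<eta> \<in> carrier Diff_half \<and> (\<forall>x\<ge>0. \<eta> (\<phi> x) = \<phi> (\<eta> x))"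
proof -
  have "\<eta> \<otimes>\<^bsub>Diff_half\<^esub> \<phi> = \<phi> \<otimes>\<^bsub>Diff_half\<^esub> \<eta> \<longleftrightarrow> (\<forall>x\<ge>0. \<eta> (\<phi> x) = \<phi> (\<eta> x))"
    if "\<eta> \<in> carrier Diff_half"
    using that phi by (auto simp: Diff_half_mult fun_eq_iff restrict_def)
  then show ?thesis
    by (auto simp: D.centralizer_iff)
qed

lemma Z_simps:
  "\<one>\<^bsub>Z\<^esub> = (\<lambda>x\<in>{0..}. x)"
  "\<eta> \<in> carrier Z \<Longrightarrow> \<eta>' \<in> carrier Z \<Longrightarrow> \<eta> \<otimes>\<^bsub>Z\<^esub> \<eta>' = (\<lambda>x\<in>{0..}. \<eta> (\<eta>' x))"
  using Diff_half_one Diff_half_mult by (auto simp: centralizer_of_def)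

lemma phi_eq_iff: "0 \<le> x \<Longrightarrow> \<phi> x = x \<longleftrightarrow> x = 0"
  using phi_gt[of x] by (cases "x = 0") auto

context
  fixes \<eta> assumes eta: "\<eta> \<in> carrier Z"
begin

lemma Z_smooth: "smooth_on {0..} \<eta>"
  using eta by (simp add: Z_iff Diff_half_iff)

lemma Z_Bij: "\<eta> \<in> Bij {0..}"
  using eta by (simp add: Z_iff Diff_half_iff)

lemma Z_nonneg: "0 \<le> x \<Longrightarrow> 0 \<le> \<eta> x"
  using Bij_app[OF Z_Bij, of x] by simp

lemma Z_inj: "inj_on \<eta> {0..}"
  using Z_Bij by (simp add: Bij_def bij_betw_def)

lemma Z_commute: "0 \<le> x \<Longrightarrow> \<eta> (\<phi> x) = \<phi> (\<eta> x)"
  using eta by (simp add: Z_iff)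

text \<open>
  The point \<open>0\<close> is the only fixed point of \<open>\<phi>\<close>, and commuting maps preserve fixed points.
\<close>
lemma Z_0: "\<eta> 0 = 0"
  using Z_commute[of 0] phi_eq_iff[OF Z_nonneg[of 0]] by simp

lemma Z_strict_mono: "0 \<le> x \<Longrightarrow> x < y \<Longrightarrow> \<eta> x < \<eta> y"
  using half_line_strict_mono[OF smooth_on_imp_continuous_on[OF Z_smooth] Z_inj Z_0 Z_nonneg] .

lemma Z_eq_0_iff: "0 \<le> x \<Longrightarrow> \<eta> x = 0 \<longleftrightarrow> x = 0"
  using Z_strict_mono[of 0 x] Z_0 by (cases "x = 0") auto

end

lemma phi_Z: "\<phi> \<in> carrier Z"
  using phi by (simp add: Z_iff)

lemma phi_pow_Z: "phi_pow n \<in> carrier Z"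
  unfolding phi_pow_def D.centralizer_iff
  using D.int_pow_mult[OF phi, of n 1] D.int_pow_mult[OF phi, of 1 n] phi
  by (simp add: add.commute)

lemma phi_pow_1 [simp]: "phi_pow 1 = \<phi>"
  using phi by (simp add: phi_pow_def)

lemma phi_pow_0 [simp]: "0 \<le> x \<Longrightarrow> phi_pow 0 x = x"
  by (simp add: phi_pow_def Diff_half_one)

lemma phi_pow_add: "0 \<le> x \<Longrightarrow> phi_pow (m + n) x = phi_pow m (phi_pow n x)"
  using D.int_pow_mult[OF phi, of m n] phi by (simp add: phi_pow_def Diff_half_mult)

lemmas phi_pow_nonneg [simp] = Z_nonneg[OF phi_pow_Z] and phi_pow_at_0 [simp] = Z_0[OF phi_pow_Z]
  and phi_pow_eq_0_iff [simp] = Z_eq_0_iff[OF phi_pow_Z]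

lemma phi_pow_neg_cancel [simp]:
  "0 \<le> x \<Longrightarrow> phi_pow n (phi_pow (- n) x) = x" "0 \<le> x \<Longrightarrow> phi_pow (- n) (phi_pow n x) = x"
  using phi_pow_add[of x n "- n"] phi_pow_add[of x "- n" n] by auto

lemma phi_pow_gt:
  assumes "0 < x" "0 < n"
  shows "x < phi_pow n x"
  using assms(2,1)
proof (induction n rule: int_gr_induct)
  case base
  then show ?case by (simp add: phi_gt)
next
  case (step i)
  then have "phi_pow i x < \<phi> (phi_pow i x)" by (intro phi_gt) auto
  moreover have "phi_pow (i + 1) x = \<phi> (phi_pow i x)"
    using phi_pow_add[of x 1 i] step by (simp add: add.commute)
  ultimately show ?case using step by simp
qed

lemma phi_pow_ge: "0 \<le> x \<Longrightarrow> 0 \<le> n \<Longrightarrow> x \<le> phi_pow n x"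
  using phi_pow_gt[of x n] by (cases "x = 0"; cases "n = 0") auto

lemma phi_pow_fixed_iff: "0 < x \<Longrightarrow> phi_pow n x = x \<longleftrightarrow> n = 0"
proof -
  assume x: "0 < x"
  have "phi_pow n x \<noteq> x" if "n < 0"
  proof
    assume "phi_pow n x = x"
    then have "phi_pow (- n) x = x" using phi_pow_neg_cancel(2)[of x n] x by simp
    then show False using phi_pow_gt[OF x, of "- n"] that by simp
  qed
  then show ?thesis using phi_pow_gt[OF x, of n] x
    by (metis less_irrefl linorder_neqE phi_pow_0 less_imp_le)
qed

text \<open>
  The backward orbit decreases, and its limit is a fixed point of \<open>\<phi>\<close>.
\<close>
lemma phi_pow_tendsto_0:
  assumes "0 \<le> x"
  shows "(\<lambda>n. phi_pow (- int n) x) \<longlonglongrightarrow> 0"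
proof -
  let ?u = "\<lambda>n. phi_pow (- int n) x"
  have phi_u: "\<phi> (?u (Suc n)) = ?u n" for n
    using phi_pow_add[OF assms, of 1 "- int (Suc n)"] by simp
  have nonneg: "0 \<le> ?u n" for n using assms by simp
  have "?u (Suc n) \<le> ?u n" for n
    using phi_pow_ge[OF nonneg, of 1 "Suc n"] phi_u[of n] by simp
  then have "decseq ?u" by (rule decseq_SucI)
  then obtain l where l: "?u \<longlonglongrightarrow> l"
    using decseq_convergent nonneg by metis
  have l0: "0 \<le> l"
    using l nonneg by (intro LIMSEQ_le_const) auto
  have "(\<lambda>n. \<phi> (?u (Suc n))) \<longlonglongrightarrow> \<phi> l"
    by (rule continuous_on_tendsto_compose[OF smooth_on_imp_continuous_on[OF Z_smooth[OF phi_Z]] LIMSEQ_Suc[OF l]])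
      (use l0 assms in auto)
  then have "\<phi> l = l"
    unfolding phi_u using l LIMSEQ_unique by blast
  then show ?thesis
    using l l0 phi_eq_iff by simp
qed

subsection \<open>The deck group\<close>

lemma deck_Rt [simp]: "p \<in> Rt \<Longrightarrow> deck n p \<in> Rt"
  by (cases p) (auto simp: deck_def Rt_iff)

lemma deck_0 [simp]: "p \<in> Rt \<Longrightarrow> deck 0 p = p"
  by (cases p) (auto simp: deck_def Rt_iff)

lemma deck_add: "p \<in> Rt \<Longrightarrow> deck (m + n) p = deck m (deck n p)"
  by (cases p) (auto simp: deck_def Rt_iff phi_pow_add power_int_add)

lemma deck_neg_cancel [simp]:
  "p \<in> Rt \<Longrightarrow> deck n (deck (- n) p) = p" "p \<in> Rt \<Longrightarrow> deck (- n) (deck n p) = p"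
  using deck_add[of p n "- n"] deck_add[of p "- n" n] by auto

lemma lam_powi_eq_1: "norm (lam powi n) = 1 \<Longrightarrow> n = 0"
  using norm_lam power_int_strict_increasing[of 0 n "norm lam"]
    power_int_strict_increasing[of n 0 "norm lam"]
  by (auto simp: norm_power_int) (metis less_irrefl linorder_neqE)

lemma deck_free: "p \<in> Rt \<Longrightarrow> deck n p = p \<Longrightarrow> n = 0"
proof (cases p)
  case (Pair z x)
  assume "p \<in> Rt" "deck n p = p"
  then have "0 \<le> x" "x = 0 \<Longrightarrow> z \<noteq> 0" "lam powi n * z = z" "phi_pow n x = x"
    by (auto simp: Pair deck_def Rt_iff)
  then show "n = 0"
    using phi_pow_fixed_iff[of x n] lam_powi_eq_1[of n] by (cases "x = 0") auto
qed

lemma deck_eq_iff: "p \<in> Rt \<Longrightarrow> deck m p = deck n p \<longleftrightarrow> m = n"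
proof
  assume p: "p \<in> Rt" and "deck m p = deck n p"
  then have "deck (- n + m) p = p"
    unfolding deck_add[OF p] using p by simp
  with deck_free[OF p] show "m = n" by fastforce
qed simp

lemma deck_inj:
  "p \<in> Rt \<Longrightarrow> q \<in> Rt \<Longrightarrow> deck n p = deck n q \<longleftrightarrow> p = q"
  by (metis deck_neg_cancel(2))

lemma smooth_deck: "smooth_on Rt (deck n)"
proof -
  have "smooth_on Rt (\<lambda>p. (lam powi n * fst p, phi_pow n (snd p)))"
  proof (rule smooth_on_Pair)
    show "smooth_on Rt (\<lambda>p. lam powi n * fst p)"
      by (intro smooth_on_linear bounded_linear_mult_right[THEN bounded_linear_compose] bounded_linear_fst)
    show "smooth_on Rt (\<lambda>p. phi_pow n (snd p))"
      by (rule smooth_on_compose[OF Z_smooth[OF phi_pow_Z] smooth_on_linear[OF bounded_linear_snd]])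
        (auto simp: Rt_def)
  qed
  then show ?thesis by (rule smooth_on_cong) (auto simp: deck_def)
qed

lemma hopf_eq: "hopf lam \<phi> = restrict (deck 1) Rt"
  by (auto simp: hopf_def deck_def)

lemma deck_Bij: "restrict (deck n) Rt \<in> Bij Rt"
  by (rule Bij_restrictI[where g = "deck (- n)"]) auto

lemma hopf_generate: "generate (BijGroup Rt) {hopf lam \<phi>} = range (\<lambda>n. restrict (deck n) Rt)"
  unfolding hopf_eq
proof (rule group.generate_one_parameter[OF group_BijGroup])
  show "restrict (deck n) Rt \<in> carrier (BijGroup Rt)" for n
    by (simp add: BijGroup_simps deck_Bij)
  show "restrict (deck (m + n)) Rt = restrict (deck m) Rt \<otimes>\<^bsub>BijGroup Rt\<^esub> restrict (deck n) Rt" for m n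
    unfolding BijGroup_simps(3)[OF deck_Bij deck_Bij] by (auto simp: deck_add)
qed

lemma proj_eq:
  assumes "p \<in> Rt"
  shows "proj lam \<phi> p = range (\<lambda>n. deck n p)"
proof -
  have "proj lam \<phi> p = (\<lambda>g. g p) ` range (\<lambda>n. restrict (deck n) Rt)"
    unfolding proj_def hopf_generate by blast
  then show ?thesis
    using assms by (simp add: image_image)
qed

lemma proj_deck [simp]: "p \<in> Rt \<Longrightarrow> proj lam \<phi> (deck n p) = proj lam \<phi> p"
proof -
  assume p: "p \<in> Rt"
  have "range (\<lambda>k. deck k (deck n p)) = (\<lambda>k. deck k p) ` range (\<lambda>k. k + n)"
    unfolding image_image deck_add[OF p] ..
  also have "range (\<lambda>k::int. k + n) = UNIV"
    by (rule surj_plus_right)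
  finally show ?thesis
    using p by (simp add: proj_eq)
qed

lemma proj_eq_iff:
  "p \<in> Rt \<Longrightarrow> q \<in> Rt \<Longrightarrow> proj lam \<phi> p = proj lam \<phi> q \<longleftrightarrow> (\<exists>n. p = deck n q)"
proof
  assume p: "p \<in> Rt" and q: "q \<in> Rt" and "proj lam \<phi> p = proj lam \<phi> q"
  moreover have "p = deck 0 p" using p by simp
  ultimately have "p \<in> proj lam \<phi> q" using proj_eq[OF p] by (metis rangeI)
  then show "\<exists>n. p = deck n q" using q by (auto simp: proj_eq)
qed auto

lemma deck_open:
  assumes "openin (top_of_set Rt) U"
  shows "openin (top_of_set Rt) (deck n ` U)"
proof -
  have U: "U \<subseteq> Rt" using openin_imp_subset[OF assms] .
  have "deck n ` U = Rt \<inter> deck (- n) -` U"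
  proof
    show "deck n ` U \<subseteq> Rt \<inter> deck (- n) -` U"
      using U deck_neg_cancel by auto
    show "Rt \<inter> deck (- n) -` U \<subseteq> deck n ` U"
      by (metis IntE deck_neg_cancel(1) image_eqI subsetI vimageE)
  qed
  then show ?thesis
    using continuous_openin_preimage[OF smooth_on_imp_continuous_on[OF smooth_deck[of "- n"]] _ assms] by auto
qed

text \<open>
  Near a point of the boundary leaf an annulus \<open>r < \<bar>z\<bar> < \<bar>lam\<bar> * r\<close> meets every orbit at most
  once; near a point above the boundary a strip \<open>u < x < \<phi> u\<close> does.
\<close>
lemma ex_Reeb_chart:
  assumes "p \<in> Rt"
  shows "\<exists>U. Reeb_chart lam \<phi> U \<and> p \<in> U"
proof -
  obtain z x where p: "p = (z, x)" by (cases p)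
  have px: "0 \<le> x" "x = 0 \<Longrightarrow> z \<noteq> 0" using assms p by (auto simp: Rt_iff)
  show ?thesis
  proof (cases "x = 0")
    case True
    then have z: "z \<noteq> 0" using px by simp
    \<comment> \<open>Any \<open>r\<close> with \<open>r < \<bar>z\<bar> < \<bar>lam\<bar> * r\<close> would do.\<close>
    define r where "r = norm z / ((1 + norm lam) / 2)"
    have r: "r < norm z" "norm z < norm lam * r" "0 < r"
      using z norm_lam by (auto simp: r_def field_simps)
    define U where "U = Rt \<inter> {p. r < norm (fst p) \<and> norm (fst p) < norm lam * r}"
    have "openin (top_of_set Rt) U"
      unfolding U_def
      by (intro openin_open_Int open_Collect_conj open_Collect_less continuous_intros)
    moreover have "inj_on (proj lam \<phi>) U"
    proof (rule inj_onI)
      fix q q' assume q: "q \<in> U" "q' \<in> U" and "proj lam \<phi> q = proj lam \<phi> q'"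
      then obtain n where n: "q = deck n q'"
        using proj_eq_iff[of q q'] by (auto simp: U_def)
      have fst: "norm (fst q) = norm lam powi n * norm (fst q')"
        by (cases q') (simp add: n deck_def norm_mult norm_power_int)
      have bounds: "r < norm (fst q)" "norm (fst q) < norm lam * r"
          "r < norm (fst q')" "norm (fst q') < norm lam * r"
        using q by (auto simp: U_def)
      have "\<not> 1 \<le> n"
      proof
        assume "1 \<le> n"
        then have "norm lam powi 1 \<le> norm lam powi n"
          using norm_lam by (intro power_int_increasing) auto
        then have "norm lam * r \<le> norm lam powi n * norm (fst q')"
          using bounds r by (intro mult_mono) auto
        then show False using fst bounds by simp
      qed
      moreover have "\<not> n \<le> -1"
      proof
        assume "n \<le> -1"
        then have "norm lam powi n \<le> norm lam powi (-1)"
          using norm_lam by (intro power_int_increasing) auto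
        then have "norm (fst q) \<le> inverse (norm lam) * norm (fst q')"
          unfolding fst by (intro mult_right_mono) (auto simp: power_int_minus)
        also have "\<dots> < r"
          using bounds norm_lam by (simp add: field_simps)
        finally show False using bounds by simp
      qed
      ultimately have "n = 0" by simp
      then show "q = q'" using n q by (auto simp: U_def)
    qed
    moreover have "p \<in> U"
      using assms r by (simp add: U_def p)
    ultimately show ?thesis unfolding Reeb_chart_def by blast
  next
    case False
    then have x: "0 < x" using px by simp
    \<comment> \<open>Any \<open>u\<close> between \<open>\<phi>\<inverse> x\<close> and \<open>x\<close> would do.\<close>
    define u where "u = (x + phi_pow (-1) x) / 2"
    have ux: "phi_pow (-1) x < x"
      using phi_pow_gt[of "phi_pow (-1) x" 1] x phi_pow_neg_cancel(1)[of x 1] phi_pow_eq_0_iff[of x "-1"] phi_pow_nonneg[of x "-1"]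
      by (auto simp: less_le)
    then have u: "u < x" "0 < u" "phi_pow (-1) x < u"
      using x phi_pow_nonneg[of x "-1"] unfolding u_def by (auto simp del: phi_pow_nonneg)
    have xu: "x < \<phi> u"
      using Z_strict_mono[OF phi_Z _ u(3)] x phi_pow_neg_cancel(1)[of x 1] by simp
    define U where "U = Rt \<inter> {p. u < snd p \<and> snd p < \<phi> u}"
    have "openin (top_of_set Rt) U"
      unfolding U_def
      by (intro openin_open_Int open_Collect_conj open_Collect_less continuous_intros)
    moreover have "inj_on (proj lam \<phi>) U"
    proof (rule inj_onI)
      fix q q' assume q: "q \<in> U" "q' \<in> U" and "proj lam \<phi> q = proj lam \<phi> q'"
      then obtain n where n: "q = deck n q'"
        using proj_eq_iff[of q q'] by (auto simp: U_def)
      have no: "\<not> 1 \<le> n" if "t = phi_pow n s" "u < s" "s < \<phi> u" "t < \<phi> u" for s t n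
      proof
        assume "1 \<le> n"
        have "\<phi> u < \<phi> s" using Z_strict_mono[OF phi_Z] u that by simp
        also have "\<phi> s \<le> phi_pow (n - 1) (\<phi> s)"
          using \<open>1 \<le> n\<close> u that by (intro phi_pow_ge) (auto intro!: Z_nonneg[OF phi_Z])
        also have "\<dots> = t"
          using phi_pow_add[of s "n - 1" 1] that u by simp
        finally show False using that by simp
      qed
      have snd: "snd q = phi_pow n (snd q')" "snd q' = phi_pow (- n) (snd q)"
        using q n by (cases q'; auto simp: deck_def U_def Rt_iff)+
      have "\<not> 1 \<le> n" "\<not> 1 \<le> - n"
        by (rule no[OF snd(1)] no[OF snd(2)]; use q in \<open>auto simp: U_def\<close>)+
      then have "n = 0" by simp
      then show "q = q'" using n q by (auto simp: U_def)
    qed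
    moreover have "p \<in> U"
      using assms u xu by (simp add: U_def p)
    ultimately show ?thesis unfolding Reeb_chart_def by blast
  qed
qed

section \<open>The centralizer of the deck transformation\<close>

abbreviation K where "K \<equiv> Kgroup lam \<phi>"

abbreviation scalings where "scalings \<equiv> Cstar \<times>\<times> Z"

text \<open>
  This is the action \<open>Kact\<close> computed on a representative of a coset.
\<close>
definition scaling_act :: "complex \<times> (real \<Rightarrow> real) \<Rightarrow> (real \<Rightarrow> complex) \<Rightarrow> real \<Rightarrow> complex" where
  "scaling_act = (\<lambda>(a, \<eta>) b. \<lambda>x\<in>{0..}. inverse a * b (\<eta> x))"

definition affine_group where "affine_group = semidirect K scalings scaling_act"

lemma K_iff: "b \<in> carrier K \<longleftrightarrow>
    b \<in> extensional {0..} \<and> smooth_on {0..} b \<and> (\<forall>x\<ge>0. b (\<phi> x) = lam * b x)"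
  by (simp add: Kgroup_def)

lemma K_simps:
  "\<one>\<^bsub>K\<^esub> = (\<lambda>x\<in>{0..}. 0)" "b \<otimes>\<^bsub>K\<^esub> c = (\<lambda>x\<in>{0..}. b x + c x)"
  by (simp_all add: Kgroup_def)

lemma phi_nonneg: "0 \<le> x \<Longrightarrow> 0 \<le> \<phi> x"
  by (rule Z_nonneg[OF phi_Z])

text \<open>
  At the fixed point \<open>0\<close> of \<open>\<phi>\<close> the functional equation reads \<open>b 0 = lam * b 0\<close>.  This is why
  translation by \<open>b\<close> preserves the boundary leaf.
\<close>
lemma K_0:
  assumes "b \<in> carrier K"
  shows "b 0 = 0"
proof -
  have "b 0 = lam * b 0"
    using assms phi_0 unfolding K_iff by (metis order_refl)
  moreover have "lam \<noteq> 1" using norm_lam by auto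
  ultimately show ?thesis by simp
qed

lemma K_I:
  assumes "smooth_on {0..} b" "\<And>x. 0 \<le> x \<Longrightarrow> b (\<phi> x) = lam * b x"
  shows "restrict b {0..} \<in> carrier K"
  unfolding K_iff
proof (intro conjI allI impI)
  show "smooth_on {0..} (restrict b {0..})"
    by (rule smooth_on_cong[OF assms(1)]) simp
  show "restrict b {0..} (\<phi> x) = lam * restrict b {0..} x" if "0 \<le> x" for x
    using that phi_nonneg assms(2) by simp
qed simp

lemma K_group: "group K"
proof (rule groupI)
  show "b \<otimes>\<^bsub>K\<^esub> c \<in> carrier K" if "b \<in> carrier K" "c \<in> carrier K" for b c
    unfolding K_simps using that by (intro K_I smooth_on_add) (auto simp: K_iff distrib_left)
  show "\<one>\<^bsub>K\<^esub> \<in> carrier K"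
    unfolding K_simps by (intro K_I) auto
  show "b \<otimes>\<^bsub>K\<^esub> c \<otimes>\<^bsub>K\<^esub> d = b \<otimes>\<^bsub>K\<^esub> (c \<otimes>\<^bsub>K\<^esub> d)" for b c d
    by (auto simp: K_simps add.assoc)
  show "\<one>\<^bsub>K\<^esub> \<otimes>\<^bsub>K\<^esub> b = b" if "b \<in> carrier K" for b
    using that by (auto simp: K_simps K_iff extensional_def)
  show "\<exists>c\<in>carrier K. c \<otimes>\<^bsub>K\<^esub> b = \<one>\<^bsub>K\<^esub>" if "b \<in> carrier K" for b
  proof
    show "(\<lambda>x\<in>{0..}. - b x) \<in> carrier K"
      using that smooth_on_linear_compose[OF bounded_linear_minus[OF bounded_linear_ident]]
      by (intro K_I) (auto simp: K_iff)
  qed (auto simp: K_simps)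
qed

lemma smooth_mult_compose:
  assumes "smooth_on {0..} b" "\<eta> \<in> carrier Z"
  shows "smooth_on {0..} (\<lambda>x. (c::complex) * b (\<eta> x))"
proof (rule smooth_on_linear_compose[OF bounded_linear_mult_right])
  show "smooth_on {0..} (\<lambda>x. b (\<eta> x))"
    by (rule smooth_on_compose[OF assms(1) Z_smooth[OF assms(2)]]) (use Z_nonneg[OF assms(2)] in auto)
qed

lemma scalings_iff:
  "(a, \<eta>) \<in> carrier scalings \<longleftrightarrow> a \<noteq> 0 \<and> \<eta> \<in> carrier Z"
  by (simp add: Cstar_def)

lemma group_scalings: "group scalings"
  by (rule DirProd_group[OF Cstar_group Z.group_axioms])

sublocale affine_group: right_action K scalings scaling_act
proof (intro right_action.intro K_group group_scalings right_action_axioms.intro)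
  fix h k assume "h \<in> carrier scalings" "k \<in> carrier K"
  moreover obtain a \<eta> where "h = (a, \<eta>)" by (cases h)
  ultimately have h: "h = (a, \<eta>)" "\<eta> \<in> carrier Z" and
    k: "smooth_on {0..} k" "\<And>x. 0 \<le> x \<Longrightarrow> k (\<phi> x) = lam * k x"
    by (auto simp: K_iff)
  then show "scaling_act h k \<in> carrier K"
    unfolding scaling_act_def h prod.case
    by (intro K_I smooth_mult_compose) (simp_all add: Z_commute Z_nonneg)
next
  fix h k k' assume "h \<in> carrier scalings" "k \<in> carrier K" "k' \<in> carrier K"
  then show "scaling_act h (k \<otimes>\<^bsub>K\<^esub> k') = scaling_act h k \<otimes>\<^bsub>K\<^esub> scaling_act h k'"
    by (cases h) (auto simp: scaling_act_def K_simps Z_nonneg distrib_left)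
next
  fix k assume "k \<in> carrier K"
  then show "scaling_act \<one>\<^bsub>scalings\<^esub> k = k"
    by (auto simp: scaling_act_def Z_simps Cstar_def K_iff extensional_def)
next
  fix h h' k assume "h \<in> carrier scalings" "h' \<in> carrier scalings" "k \<in> carrier K"
  then show "scaling_act (h \<otimes>\<^bsub>scalings\<^esub> h') k = scaling_act h' (scaling_act h k)"
    by (cases h; cases h') (auto simp: scaling_act_def Z_simps Z_nonneg Cstar_def)
qed

lemma group_affine_group: "group affine_group"
  unfolding affine_group_def by (rule affine_group.semidirect_group)

sublocale affine_group: group affine_group by (rule group_affine_group)

lemma affine_group_iff:
  "(b, a, \<eta>) \<in> carrier affine_group \<longleftrightarrow> b \<in> carrier K \<and> a \<noteq> 0 \<and> \<eta> \<in> carrier Z"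
  by (simp add: affine_group_def semidirect_def Cstar_def)

lemma affine_group_mult:
  "(b, a, \<eta>) \<otimes>\<^bsub>affine_group\<^esub> (b', a', \<eta>') = (scaling_act (a', \<eta>') b \<otimes>\<^bsub>K\<^esub> b', a * a', \<eta> \<otimes>\<^bsub>Z\<^esub> \<eta>')"
  by (simp add: affine_group_def semidirect_def Cstar_def)

lemma affine_group_one:
  "\<one>\<^bsub>affine_group\<^esub> = (\<lambda>x\<in>{0..}. 0, 1, \<lambda>x\<in>{0..}. x)"
  by (simp add: affine_group_def semidirect_def Cstar_def K_simps Z_simps)

text \<open>
  In a triple \<open>(b, a, \<eta>)\<close> the translation by \<open>b\<close> is performed first and \<open>(z, x) \<mapsto> (a * z, \<eta> x)\<close>
  second; this order turns the product of \<open>affine_group\<close> into composition.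
\<close>
definition affine :: "(real \<Rightarrow> complex) \<times> complex \<times> (real \<Rightarrow> real) \<Rightarrow> complex \<times> real \<Rightarrow> complex \<times> real" where
  "affine = (\<lambda>(b, a, \<eta>). \<lambda>(z, x)\<in>Rt. (a * (z + b x), \<eta> x))"

lemma affine_app: "(z, x) \<in> Rt \<Longrightarrow> affine (b, a, \<eta>) (z, x) = (a * (z + b x), \<eta> x)"
  by (simp add: affine_def)

lemma affine_Rt:
  assumes "l \<in> carrier affine_group" "p \<in> Rt"
  shows "affine l p \<in> Rt"
proof -
  obtain b a \<eta> where l: "l = (b, a, \<eta>)" by (cases l)
  obtain z x where p: "p = (z, x)" by (cases p)
  show ?thesis
    using assms K_0[of b] Z_eq_0_iff[of \<eta> x] Z_nonneg[of \<eta> x]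
    by (auto simp: l p affine_app affine_group_iff Rt_iff)
qed

lemma affine_mult:
  assumes "l \<in> carrier affine_group" "l' \<in> carrier affine_group" "p \<in> Rt"
  shows "affine (l \<otimes>\<^bsub>affine_group\<^esub> l') p = affine l (affine l' p)"
proof -
  obtain b a \<eta> where l: "l = (b, a, \<eta>)" by (cases l)
  obtain b' a' \<eta>' where l': "l' = (b', a', \<eta>')" by (cases l')
  obtain z x where p: "p = (z, x)" by (cases p)
  have "(a' * (z + b' x), \<eta>' x) \<in> Rt"
    using affine_Rt[OF assms(2,3)] assms(3) by (simp add: l' p affine_app)
  moreover have "0 \<le> x" using assms(3) by (simp add: p Rt_iff)
  ultimately show ?thesis
    using assms by (simp add: l l' p affine_group_mult affine_app affine_group_iff K_simps Z_simps scaling_act_def distrib_left)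
qed

lemma affine_one: "p \<in> Rt \<Longrightarrow> affine \<one>\<^bsub>affine_group\<^esub> p = p"
  by (cases p) (auto simp: affine_app affine_group_one Rt_iff)

lemma affine_restrict: "affine l = restrict (affine l) Rt"
  by (cases l) (auto simp: affine_def)

lemma affine_inverse:
  assumes "l \<in> carrier affine_group" "p \<in> Rt"
  shows "affine (inv\<^bsub>affine_group\<^esub> l) (affine l p) = p" "affine l (affine (inv\<^bsub>affine_group\<^esub> l) p) = p"
  using assms by (simp_all add: affine_one flip: affine_mult)

lemma affine_Bij: "l \<in> carrier affine_group \<Longrightarrow> affine l \<in> Bij Rt"
  by (subst affine_restrict) (rule Bij_restrictI[where g = "affine (inv\<^bsub>affine_group\<^esub> l)"]; simp add: affine_Rt affine_inverse)

lemma inv_into_affine: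
  "l \<in> carrier affine_group \<Longrightarrow> p \<in> Rt \<Longrightarrow> inv_into Rt (affine l) p = affine (inv\<^bsub>affine_group\<^esub> l) p"
  by (subst (1) affine_restrict) (rule inv_into_restrict_eq; simp add: affine_Rt affine_inverse)

lemma affine_hom: "affine \<in> hom affine_group (BijGroup Rt)"
proof (rule homI)
  show "affine l \<in> carrier (BijGroup Rt)" if "l \<in> carrier affine_group" for l
    using that by (simp add: BijGroup_simps affine_Bij)
  show "affine (l \<otimes>\<^bsub>affine_group\<^esub> l') = affine l \<otimes>\<^bsub>BijGroup Rt\<^esub> affine l'" if "l \<in> carrier affine_group" "l' \<in> carrier affine_group" for l l'
    unfolding BijGroup_simps(3)[OF affine_Bij[OF that(1)] affine_Bij[OF that(2)]]
    by (subst affine_restrict) (rule restrict_ext, rule affine_mult[OF that])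
qed

lemma affine_group_hom: "group_hom affine_group (BijGroup Rt) affine"
  using group_affine_group group_BijGroup affine_hom by (simp add: group_hom_def group_hom_axioms_def)

text \<open>
  On the boundary leaf \<open>b\<close> vanishes, so \<open>a\<close> can be read off there, and then \<open>b\<close> from the other
  leaves.
\<close>
lemma affine_inj:
  assumes l: "l \<in> carrier affine_group" "l' \<in> carrier affine_group" and eq: "affine l = affine l'"
  shows "l = l'"
proof -
  obtain b a \<eta> where l1: "l = (b, a, \<eta>)" by (cases l)
  obtain b' a' \<eta>' where l2: "l' = (b', a', \<eta>')" by (cases l')
  have *: "a * (z + b x) = a' * (z + b' x)" "\<eta> x = \<eta>' x" if "(z, x) \<in> Rt" for z x
    using fun_cong[OF eq, of "(z, x)"] that by (auto simp: l1 l2 affine_app)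
  have K: "b \<in> carrier K" "b' \<in> carrier K" and Z: "\<eta> \<in> carrier Z" "\<eta>' \<in> carrier Z" and a: "a \<noteq> 0"
    using l by (auto simp: l1 l2 affine_group_iff)
  have "a = a'"
    using *(1)[of 1 0] K[THEN K_0] by (simp add: Rt_iff)
  moreover have "b = b'"
  proof (rule extensionalityI)
    show "b x = b' x" if "x \<in> {0..}" for x
      using *(1)[of 1 x] that a \<open>a = a'\<close> by (auto simp: Rt_iff)
  qed (use K in \<open>auto simp: K_iff\<close>)
  moreover have "\<eta> = \<eta>'"
  proof (rule extensionalityI)
    show "\<eta> x = \<eta>' x" if "x \<in> {0..}" for x
      using *(2)[of 1 x] that by (auto simp: Rt_iff)
  qed (use Z[THEN Z_Bij] in \<open>auto dest: Bij_imp_extensional\<close>)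
  ultimately show ?thesis by (simp add: l1 l2)
qed

lemma affine_smooth:
  assumes "l \<in> carrier affine_group"
  shows "smooth_on Rt (affine l)"
proof -
  obtain b a \<eta> where l: "l = (b, a, \<eta>)" by (cases l)
  have b: "smooth_on {0..} b" and eta: "smooth_on {0..} \<eta>"
    using assms by (auto simp: l affine_group_iff K_iff Z_smooth)
  have snd: "smooth_on Rt snd" "snd ` Rt \<subseteq> {0..}"
    by (auto intro: smooth_on_linear bounded_linear_snd simp: Rt_def)
  have "smooth_on Rt (\<lambda>p. (a * (fst p + b (snd p)), \<eta> (snd p)))"
    by (intro smooth_on_Pair smooth_on_linear_compose[OF bounded_linear_mult_right] smooth_on_add
        smooth_on_linear[OF bounded_linear_fst] smooth_on_compose[OF b snd] smooth_on_compose[OF eta snd])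
  then show ?thesis
    by (rule smooth_on_cong) (auto simp: l affine_def)
qed

lemma leaf_iff:
  "0 \<le> x \<Longrightarrow> (z, y) \<in> leaf x \<longleftrightarrow> y = x \<and> (z, y) \<in> Rt"
  by (auto simp: leaf_def Rt_iff)

lemma affine_leaf_subset:
  assumes "(b, a, \<eta>) \<in> carrier affine_group" "0 \<le> x"
  shows "affine (b, a, \<eta>) ` leaf x \<subseteq> leaf (\<eta> x)"
proof (rule image_subsetI)
  fix p assume "p \<in> leaf x"
  then obtain z where zx: "p = (z, x)" and p: "(z, x) \<in> Rt"
    using assms(2) by (cases p) (auto simp: leaf_iff)
  have "affine (b, a, \<eta>) (z, x) \<in> Rt"
    by (rule affine_Rt[OF assms(1) p])
  moreover have "0 \<le> \<eta> x"
    using assms by (auto simp: affine_group_iff Z_nonneg)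
  ultimately show "affine (b, a, \<eta>) p \<in> leaf (\<eta> x)"
    using p by (simp add: affine_app zx leaf_iff)
qed

lemma affine_leaf:
  assumes "(b, a, \<eta>) \<in> carrier affine_group" "0 \<le> x"
  shows "affine (b, a, \<eta>) ` leaf x = leaf (\<eta> x)"
proof
  show "affine (b, a, \<eta>) ` leaf x \<subseteq> leaf (\<eta> x)"
    by (rule affine_leaf_subset[OF assms])
  obtain b' a' \<eta>' where inv: "inv\<^bsub>affine_group\<^esub> (b, a, \<eta>) = (b', a', \<eta>')"
    by (cases "inv\<^bsub>affine_group\<^esub> (b, a, \<eta>)")
  have l': "(b', a', \<eta>') \<in> carrier affine_group"
    using assms(1) affine_group.inv_closed inv by metis
  have eta: "0 \<le> \<eta> x"
    using assms by (auto simp: affine_group_iff Z_nonneg)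
  have p: "(1, x) \<in> leaf x" using assms by (simp add: leaf_iff Rt_iff)
  have "affine (b', a', \<eta>') (affine (b, a, \<eta>) (1, x)) \<in> leaf (\<eta>' (\<eta> x))"
    using affine_leaf_subset[OF assms] affine_leaf_subset[OF l' eta] p by blast
  moreover have "affine (b', a', \<eta>') (affine (b, a, \<eta>) (1, x)) = (1, x)"
    unfolding inv[symmetric] using assms by (intro affine_inverse) (auto simp: Rt_iff)
  ultimately have "\<eta>' (\<eta> x) = x"
    using l' eta by (auto simp: leaf_iff affine_group_iff Z_nonneg)
  then have sub: "affine (b', a', \<eta>') ` leaf (\<eta> x) \<subseteq> leaf x"
    using affine_leaf_subset[OF l' eta] by simp
  show "leaf (\<eta> x) \<subseteq> affine (b, a, \<eta>) ` leaf x"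
  proof
    fix q assume q: "q \<in> leaf (\<eta> x)"
    then have "q \<in> Rt" using eta by (cases q) (auto simp: leaf_iff)
    then have "q = affine (b, a, \<eta>) (affine (b', a', \<eta>') q)"
      unfolding inv[symmetric] using assms(1) by (simp add: affine_inverse)
    then show "q \<in> affine (b, a, \<eta>) ` leaf x"
      using sub q by blast
  qed
qed

lemma affine_leaves:
  "l \<in> carrier affine_group \<Longrightarrow> S \<in> leaves_Rt \<Longrightarrow> affine l ` S \<in> leaves_Rt"
  using affine_leaf Z_nonneg by (cases l) (force simp: leaves_Rt_def affine_group_iff)

lemma affine_leafwise:
  assumes "l \<in> carrier affine_group"
  shows "leafwise_holomorphic_on Rt (affine l)"
proof -
  obtain b a \<eta> where l: "l = (b, a, \<eta>)" by (cases l)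
  have "(\<lambda>z. fst (affine l (z, x))) holomorphic_on {z. (z, x) \<in> Rt}" for x
  proof (rule holomorphic_transform)
    show "(\<lambda>z. a * (z + b x)) holomorphic_on {z. (z, x) \<in> Rt}"
      by (intro holomorphic_intros)
  qed (simp add: l affine_app)
  then show ?thesis
    unfolding leafwise_holomorphic_on_def by (auto simp: l affine_app)
qed

definition deck_param :: "int \<Rightarrow> (real \<Rightarrow> complex) \<times> complex \<times> (real \<Rightarrow> real)" where
  "deck_param n = (\<lambda>x\<in>{0..}. 0, lam powi n, phi_pow n)"

lemma deck_param_closed: "deck_param n \<in> carrier affine_group"
  using affine_group.K.one_closed by (simp add: deck_param_def affine_group_iff phi_pow_Z K_simps)

lemma affine_deck_param: "affine (deck_param n) = restrict (deck n) Rt"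
  by (auto simp: affine_def deck_param_def deck_def Rt_iff)

text \<open>
  The action of \<open>(lam, \<phi>)\<close> on \<open>b\<close> is \<open>b \<mapsto> lam\<inverse> b \<circ> \<phi>\<close>, so the equation that defines \<open>K\<close> says
  that it is trivial.
\<close>
lemma deck_param_central:
  "l \<in> carrier affine_group \<Longrightarrow> l \<otimes>\<^bsub>affine_group\<^esub> deck_param 1 = deck_param 1 \<otimes>\<^bsub>affine_group\<^esub> l"
proof -
  assume l: "l \<in> carrier affine_group"
  obtain b a \<eta> where l1: "l = (b, a, \<eta>)" by (cases l)
  have Z: "\<eta> \<otimes>\<^bsub>Z\<^esub> \<phi> = \<phi> \<otimes>\<^bsub>Z\<^esub> \<eta>"
    using l phi_Z by (auto simp: l1 affine_group_iff Z_simps Z_commute)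
  have "scaling_act (lam, \<phi>) b \<otimes>\<^bsub>K\<^esub> (\<lambda>x\<in>{0..}. 0) = scaling_act (a, \<eta>) (\<lambda>x\<in>{0..}. 0) \<otimes>\<^bsub>K\<^esub> b"
    using l by (auto simp: l1 affine_group_iff K_simps scaling_act_def K_iff Z_nonneg)
  with Z show ?thesis
    by (simp add: l1 deck_param_def affine_group_mult mult.commute)
qed

lemma affine_commute:
  "l \<in> carrier affine_group \<Longrightarrow> p \<in> Rt \<Longrightarrow> affine l (deck 1 p) = deck 1 (affine l p)"
  using affine_mult[of l "deck_param 1" p] affine_mult[of "deck_param 1" l p] deck_param_central[of l] deck_param_closed[of 1]
  by (simp add: affine_deck_param affine_Rt)

lemma commute_deck_powers:
  assumes F: "\<And>p. p \<in> Rt \<Longrightarrow> F p \<in> Rt"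
    and comm: "\<And>p. p \<in> Rt \<Longrightarrow> F (deck 1 p) = deck k (F p)" and p: "p \<in> Rt"
  shows "F (deck n p) = deck (k * n) (F p)"
proof (induction n rule: int_induct[where k = 0])
  case base
  then show ?case using p F by simp
next
  case (step1 i)
  have "deck (i + 1) p = deck 1 (deck i p)"
    using deck_add[OF p, of 1 i] by (simp add: add.commute)
  then have "F (deck (i + 1) p) = deck k (deck (k * i) (F p))"
    using step1 comm p by simp
  then show ?case
    using deck_add[OF F[OF p], of k "k * i"] by (simp add: distrib_left add.commute)
next
  case (step2 i)
  have "deck i p = deck 1 (deck (i - 1) p)"
    using deck_add[OF p, of 1 "i - 1"] by simp
  then have "deck k (F (deck (i - 1) p)) = F (deck i p)"
    using comm p by simp
  also have "\<dots> = deck k (deck (k * (i - 1)) (F p))"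
    using step2 deck_add[OF F[OF p], of k "k * (i - 1)"] by (simp add: right_diff_distrib)
  finally show ?case
    using deck_inj[OF F deck_Rt[OF F]] p by simp
qed

text \<open>
  Each \<open>z\<close> with \<open>\<bar>z\<bar> \<ge> 1\<close> is \<open>lam\<^sup>m * w\<close> with \<open>m \<ge> 0\<close> and \<open>w\<close> in the annulus
  \<open>1 \<le> \<bar>w\<bar> \<le> \<bar>lam\<bar>\<close>.  The corresponding point \<open>(w, \<phi>\<^sup>-\<^sup>m x)\<close> lies in a fixed compact subset of
  \<open>Rt\<close>, on which \<open>f\<close> is bounded by some \<open>B\<close>; scaling back gives \<open>\<bar>f (z, x)\<bar> \<le> B * \<bar>lam\<bar>\<^sup>m \<le> B * \<bar>z\<bar>\<close>.
  An entire function of linear growth is affine.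
\<close>
lemma entire_slice_affine:
  assumes hol: "\<And>y. 0 < y \<Longrightarrow> (\<lambda>w. f (w, y)) holomorphic_on UNIV"
    and cont: "continuous_on Rt f"
    and scale: "\<And>n p. p \<in> Rt \<Longrightarrow> f (deck n p) = lam powi n * f p"
    and x: "0 < x"
  shows "\<exists>A C. \<forall>w. f (w, x) = A * w + C"
proof -
  let ?A = "(cball (0::complex) (norm lam) - ball 0 1) \<times> {0..x}"
  have "?A \<subseteq> Rt" by (auto simp: Rt_iff)
  then have "continuous_on ?A f" by (rule continuous_on_subset[OF cont])
  moreover have "compact ?A"
    by (intro compact_Times compact_diff compact_cball open_ball) auto
  ultimately have "bounded (f ` ?A)"
    using compact_continuous_image compact_imp_bounded by blast
  then obtain B where B: "\<And>p. p \<in> ?A \<Longrightarrow> norm (f p) \<le> B"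
    unfolding bounded_iff by blast
  have "norm (f (0 + 1, x)) \<le> B"
    using x norm_lam by (intro B) auto
  then have B0: "0 \<le> B"
    by (meson norm_ge_zero order_trans)
  have bound: "norm (f (z, x)) \<le> B * norm z ^ 1" if z: "1 \<le> norm z" for z
  proof -
    obtain n where "norm z < norm lam ^ n"
      using real_arch_pow[OF norm_lam] by blast
    then have n: "norm z < norm lam ^ (LEAST n. norm z < norm lam ^ n)"
      by (rule LeastI)
    obtain m where m: "(LEAST n. norm z < norm lam ^ n) = Suc m"
      using n z by (cases "LEAST n. norm z < norm lam ^ n") auto
    have le: "norm lam ^ m \<le> norm z"
      using not_less_Least[of m "\<lambda>n. norm z < norm lam ^ n"] m by simp
    define w where "w = z / lam ^ m"
    define y where "y = phi_pow (- int m) x"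
    have zx: "(z, x) = deck (int m) (w, y)"
      using x by (simp add: deck_def w_def y_def)
    have pos: "0 < norm lam ^ m" by simp
    have "1 \<le> norm w" "norm w \<le> norm lam"
      using le n pos unfolding m w_def by (simp_all add: norm_divide norm_power field_simps)
    moreover have "0 \<le> y" "y \<le> x"
      using x phi_pow_ge[of y "int m"] phi_pow_neg_cancel(1)[of x "int m"] by (auto simp: y_def)
    ultimately have wy: "(w, y) \<in> ?A" by auto
    then have wy_Rt: "(w, y) \<in> Rt" using \<open>?A \<subseteq> Rt\<close> by blast
    have "norm (f (z, x)) = norm lam ^ m * norm (f (w, y))"
      unfolding zx scale[OF wy_Rt] by (simp add: norm_mult norm_power)
    also have "\<dots> \<le> norm lam ^ m * B"
      by (rule mult_left_mono[OF B[OF wy]]) simp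
    also have "\<dots> \<le> B * norm z"
      using mult_right_mono[OF le B0] by (simp add: mult.commute)
    finally show ?thesis by simp
  qed
  have "f (w, x) = deriv (\<lambda>w. f (w, x)) 0 * w + f (0, x)" for w
    using Liouville_polynomial[where \<xi> = w, OF hol[OF x] bound] by simp
  then show ?thesis by blast
qed

text \<open>
  If \<open>f (w, x) = A * w + C\<close> for all \<open>w\<close>, then the functional equation gives
  \<open>f (w, \<phi>\<^sup>-\<^sup>n x) = A * w + C / lam\<^sup>n\<close>, and \<open>n \<longrightarrow> \<infinity>\<close> yields \<open>f (w, 0) = A * w\<close>.  So \<open>A\<close> is
  \<open>f (1, 0)\<close>, whatever \<open>x\<close> is.
\<close>
lemma equivariant_affine:
  assumes hol: "\<And>y. 0 < y \<Longrightarrow> (\<lambda>w. f (w, y)) holomorphic_on UNIV"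
    and cont: "continuous_on Rt f"
    and scale: "\<And>n p. p \<in> Rt \<Longrightarrow> f (deck n p) = lam powi n * f p"
    and p: "(z, x) \<in> Rt"
  shows "f (z, x) = f (1, 0) * (z - 1) + f (1, x)"
proof -
  have boundary: "f (w, 0) = A * w" if AC: "\<And>w. f (w, x) = A * w + C" and x: "0 < x" and w: "w \<noteq> 0" for A C w x
  proof -
    let ?y = "\<lambda>n. phi_pow (- int n) x"
    have y: "(w, ?y n) \<in> Rt" for n
      using x w by (auto simp: Rt_iff)
    have "f (w, ?y n) = A * w + C * inverse lam ^ n" for n
    proof -
      have "deck (int n) (w, ?y n) = (lam ^ n * w, x)"
        using x by (simp add: deck_def)
      then have "lam ^ n * f (w, ?y n) = A * (lam ^ n * w) + C"
        using scale[OF y[of n], of "int n"] AC by simp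
      then show ?thesis
        by (simp add: field_simps)
    qed
    moreover have "(\<lambda>n. A * w + C * inverse lam ^ n) \<longlonglongrightarrow> A * w + C * 0"
      using norm_lam by (intro tendsto_intros LIMSEQ_power_zero) (simp add: norm_inverse inverse_less_1_iff)
    ultimately have "(\<lambda>n. f (w, ?y n)) \<longlonglongrightarrow> A * w"
      by simp
    moreover have "(\<lambda>n. f (w, ?y n)) \<longlonglongrightarrow> f (w, 0)"
      by (rule continuous_on_tendsto_compose[OF cont tendsto_Pair[OF tendsto_const phi_pow_tendsto_0]])
        (use x w y in \<open>auto simp: Rt_iff\<close>)
    ultimately show ?thesis
      using LIMSEQ_unique by blast
  qed
  show ?thesis
  proof (cases "x = 0")
    case True
    obtain A C where AC: "\<And>w. f (w, 1) = A * w + C"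
      using entire_slice_affine[OF hol cont scale, of 1] by auto
    have "f (z, 0) = A * z" "f (1, 0) = A * 1"
      using boundary[OF AC] p True by (auto simp: Rt_iff)
    then show ?thesis using True by (simp add: algebra_simps)
  next
    case False
    then have x: "0 < x" using p by (simp add: Rt_iff)
    obtain A C where AC: "\<And>w. f (w, x) = A * w + C"
      using entire_slice_affine[OF hol cont scale x] by auto
    have "f (1, 0) = A"
      using boundary[OF AC x, of 1] by simp
    then show ?thesis using AC[of z] AC[of 1] by (simp add: algebra_simps)
  qed
qed

text \<open>
  The restriction of \<open>F\<close> to the transversal \<open>z = 1\<close> carries all the data: the heights of its
  values give \<open>\<eta>\<close>, and the first components give \<open>a = f (1, 0)\<close> and \<open>b x = f (1, x) / a - 1\<close>.  In
  particular \<open>\<eta>\<close> and \<open>b\<close> inherit smoothness from \<open>F\<close>.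
\<close>
lemma automorphism_structure:
  assumes Bij: "F \<in> Bij Rt" and smooth: "smooth_on Rt F" "smooth_on Rt (inv_into Rt F)"
    and leaves: "\<And>S. S \<in> leaves_Rt \<Longrightarrow> F ` S \<in> leaves_Rt"
    and leafwise: "leafwise_holomorphic_on Rt F"
    and comm: "\<And>p. p \<in> Rt \<Longrightarrow> F (deck 1 p) = deck 1 (F p)"
  shows "\<exists>l\<in>carrier affine_group. F = affine l"
proof -
  define f where "f = (\<lambda>p. fst (F p))"
  define \<eta> where "\<eta> = (\<lambda>x. snd (F (1, x)))"
  define \<zeta> where "\<zeta> = (\<lambda>y. snd (inv_into Rt F (1, y)))"
  have one_Rt: "(1, x) \<in> Rt" if "0 \<le> x" for x
    using that by (simp add: Rt_iff)
  have F_Rt: "F p \<in> Rt" if "p \<in> Rt" for p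
    using Bij_app[OF Bij that] .
  have snd_F: "snd (F (z, x)) = \<eta> x" if "(z, x) \<in> Rt" for z x
    using leafwise that one_Rt[of x] unfolding leafwise_holomorphic_on_def \<eta>_def
    by (metis Rt_iff)
  have F_deck: "F (deck n p) = deck n (F p)" if "p \<in> Rt" for n p
    using commute_deck_powers[of F 1 p n] F_Rt comm that by simp
  have scale: "f (deck n p) = lam powi n * f p" if "p \<in> Rt" for n p
    using F_deck[OF that, of n] by (cases "F p") (simp add: f_def deck_def)
  have f: "f (z, x) = f (1, 0) * (z - 1) + f (1, x)" if "(z, x) \<in> Rt" for z x
  proof (rule equivariant_affine[OF _ _ scale that])
    show "(\<lambda>w. f (w, y)) holomorphic_on UNIV" if "0 < y" for y
    proof -
      have "{z. (z, y) \<in> Rt} = UNIV" using that by (auto simp: Rt_iff)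
      then show ?thesis
        using leafwise unfolding leafwise_holomorphic_on_def f_def by metis
    qed
    show "continuous_on Rt f"
      unfolding f_def by (intro continuous_on_fst smooth_on_imp_continuous_on smooth)
  qed
  have nonneg: "0 \<le> \<eta> x" "0 \<le> \<zeta> x" if "0 \<le> x" for x
    using F_Rt[OF one_Rt[OF that]] Bij_inv_into(1)[OF Bij one_Rt[OF that]]
    by (auto simp: \<eta>_def \<zeta>_def Rt_def mem_Times_iff)
  have \<eta>_\<phi>: "\<eta> (\<phi> x) = \<phi> (\<eta> x)" if "0 \<le> x" for x
  proof -
    have "snd (F (deck 1 (1, x))) = \<phi> (\<eta> x)"
      using F_deck[OF one_Rt[OF that], of 1] by (cases "F (1, x)") (simp add: deck_def \<eta>_def)
    moreover have "deck 1 (1, x) = (lam, \<phi> x)" by (simp add: deck_def)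
    ultimately show ?thesis
      using snd_F[of lam "\<phi> x"] phi_nonneg[OF that] by (simp add: Rt_iff)
  qed
  have \<eta>_0: "\<eta> 0 = 0"
    using \<eta>_\<phi>[of 0] phi_eq_iff[OF nonneg(1)[of 0]] by simp
  have \<eta>_\<zeta>: "\<eta> (\<zeta> y) = y" if "0 \<le> y" for y
    using Bij_inv_into[OF Bij one_Rt[OF that]] snd_F unfolding \<zeta>_def by (metis prod.collapse snd_conv)
  have \<zeta>_\<eta>: "\<zeta> (\<eta> x) = x" if x: "0 \<le> x" for x
  proof -
    have "F ` leaf x \<in> leaves_Rt" using x leaves by (auto simp: leaves_Rt_def)
    then obtain y where y: "0 \<le> y" "F ` leaf x = leaf y" by (auto simp: leaves_Rt_def)
    have "F (1, x) \<in> leaf y"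
      using y x by (auto simp: leaf_iff one_Rt)
    then have "y = \<eta> x"
      using y(1) by (cases "F (1, x)") (auto simp: leaf_iff \<eta>_def)
    then have "(1, \<eta> x) \<in> F ` leaf x"
      using y by (simp add: leaf_iff one_Rt)
    then obtain z where z: "(z, x) \<in> Rt" "F (z, x) = (1, \<eta> x)"
      using x by (auto simp: leaf_iff)
    then show ?thesis
      using Bij_inv_into(3)[OF Bij z(1)] by (simp add: \<zeta>_def)
  qed
  have smooth_one: "smooth_on {0..} (\<lambda>x. (1, x))"
    by (intro smooth_on_Pair smooth_on_ident) simp
  have smooth_snd: "smooth_on {0..} (\<lambda>x. h (G (1, x)))"
    if "smooth_on Rt G" "bounded_linear h" for G h
    using one_Rt by (intro smooth_on_linear_compose[OF that(2)] smooth_on_compose[OF that(1) smooth_one]) auto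
  have "restrict \<eta> {0..} \<in> carrier Diff_half"
    unfolding Diff_half_iff
  proof (intro conjI)
    show "restrict \<eta> {0..} \<in> Bij {0..}"
      by (rule Bij_restrictI[where g = \<zeta>]) (use nonneg \<eta>_\<zeta> \<zeta>_\<eta> in auto)
    have "smooth_on {0..} \<eta>" "smooth_on {0..} \<zeta>"
      unfolding \<eta>_def \<zeta>_def by (rule smooth_snd; use smooth in \<open>simp add: bounded_linear_snd\<close>)+
    then show "smooth_on {0..} (restrict \<eta> {0..})"
      by (elim smooth_on_cong) simp
    show "smooth_on {0..} (inv_into {0..} (restrict \<eta> {0..}))"
    proof (rule smooth_on_cong)
      show "\<zeta> y = inv_into {0..} (restrict \<eta> {0..}) y" if "y \<in> {0..}" for y
        by (rule inv_into_restrict_eq[symmetric]) (use that nonneg \<eta>_\<zeta> \<zeta>_\<eta> in auto)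
    qed fact
  qed
  then have eta_Z: "restrict \<eta> {0..} \<in> carrier Z"
    using \<eta>_\<phi> phi_nonneg nonneg by (auto simp: Z_iff)
  define a where "a = f (1, 0)"
  define b where "b = (\<lambda>x. inverse a * (f (1, x) + - a))"
  have a: "a \<noteq> 0"
    using F_Rt[OF one_Rt[of 0]] \<eta>_0 by (cases "F (1, 0)") (auto simp: a_def f_def \<eta>_def Rt_iff)
  have fb: "f (z, x) = a * (z + b x)" if "(z, x) \<in> Rt" for z x
  proof -
    have "a * (z + b x) = a * z + (f (1, x) - a)"
      using a by (simp add: b_def distrib_left)
    then show ?thesis
      unfolding f[OF that] a_def by (simp add: algebra_simps)
  qed
  have "restrict b {0..} \<in> carrier K"
  proof (rule K_I)
    show "smooth_on {0..} b"
      unfolding b_def f_def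
      by (intro smooth_on_linear_compose[OF bounded_linear_mult_right] smooth_on_add
          smooth_on_const smooth_snd smooth bounded_linear_fst)
    show "b (\<phi> x) = lam * b x" if "0 \<le> x" for x
    proof -
      have "f (lam, \<phi> x) = lam * f (1, x)"
        using scale[OF one_Rt[OF that], of 1] by (simp add: deck_def)
      moreover have "f (lam, \<phi> x) = a * (lam + b (\<phi> x))" "f (1, x) = a * (1 + b x)"
        by (rule fb; use that phi_nonneg in \<open>simp add: Rt_iff\<close>)+
      ultimately have "a * (lam + b (\<phi> x)) = a * (lam + lam * b x)"
        by (simp add: algebra_simps)
      then show ?thesis using a by simp
    qed
  qed
  then have "(restrict b {0..}, a, restrict \<eta> {0..}) \<in> carrier affine_group"
    using a eta_Z by (simp add: affine_group_iff)
  moreover have "F = affine (restrict b {0..}, a, restrict \<eta> {0..})"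
  proof (rule extensionalityI)
    show "F \<in> extensional Rt" using Bij by (rule Bij_imp_extensional)
    show "affine (restrict b {0..}, a, restrict \<eta> {0..}) \<in> extensional Rt" by (simp add: affine_def)
    fix p assume p: "p \<in> Rt"
    obtain z x where zx: "p = (z, x)" by (cases p)
    with p have "0 \<le> x" by (simp add: Rt_iff)
    then show "F p = affine (restrict b {0..}, a, restrict \<eta> {0..}) p"
      using snd_F[of z x] fb[of z x] p by (simp add: zx affine_app prod_eq_iff f_def)
  qed
  ultimately show ?thesis by blast
qed

abbreviation C where "C \<equiv> centralizer_of Aut_Rt (hopf lam \<phi>)"

lemma C_eq: "C = BijGroup Rt\<lparr>carrier := affine ` carrier affine_group\<rparr>"
proof -
  have "carrier C = affine ` carrier affine_group"
  proof
    show "affine ` carrier affine_group \<subseteq> carrier C"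
    proof (rule image_subsetI)
      fix l assume l: "l \<in> carrier affine_group"
      have "smooth_on Rt (inv_into Rt (affine l))"
        by (rule smooth_on_cong[OF affine_smooth[OF affine_group.inv_closed[OF l]]]) (simp add: inv_into_affine l)
      moreover have "affine l \<otimes>\<^bsub>BijGroup Rt\<^esub> hopf lam \<phi> = hopf lam \<phi> \<otimes>\<^bsub>BijGroup Rt\<^esub> affine l"
        unfolding hopf_eq BijGroup_simps(3)[OF affine_Bij[OF l] deck_Bij] BijGroup_simps(3)[OF deck_Bij affine_Bij[OF l]]
        by (rule restrict_ext) (simp add: affine_commute l affine_Rt)
      ultimately show "affine l \<in> carrier C"
        using l by (simp add: centralizer_of_def Aut_Rt_def affine_Bij affine_smooth affine_leaves affine_leafwise)
    qed
    show "carrier C \<subseteq> affine ` carrier affine_group"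
    proof
      fix F assume "F \<in> carrier C"
      then have F: "F \<in> Bij Rt" "smooth_on Rt F" "smooth_on Rt (inv_into Rt F)"
          "\<And>S. S \<in> leaves_Rt \<Longrightarrow> F ` S \<in> leaves_Rt" "leafwise_holomorphic_on Rt F"
        and comm: "F \<otimes>\<^bsub>BijGroup Rt\<^esub> hopf lam \<phi> = hopf lam \<phi> \<otimes>\<^bsub>BijGroup Rt\<^esub> F"
        by (auto simp: centralizer_of_def Aut_Rt_def)
      have "F (deck 1 p) = deck 1 (F p)" if "p \<in> Rt" for p
        using fun_cong[OF comm, of p] that Bij_app[OF F(1) that]
        unfolding hopf_eq BijGroup_simps(3)[OF F(1) deck_Bij] BijGroup_simps(3)[OF deck_Bij F(1)]
        by simp
      then show "F \<in> affine ` carrier affine_group"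
        using automorphism_structure[OF F] by blast
    qed
  qed
  then show ?thesis
    by (simp add: centralizer_of_def Aut_Rt_def)
qed

lemma affine_image_subgroup: "subgroup (affine ` carrier affine_group) (BijGroup Rt)"
  by (rule group_hom.img_is_subgroup[OF affine_group_hom])

lemma C_group: "group C"
  unfolding C_eq by (rule group.subgroup_imp_group[OF group_BijGroup affine_image_subgroup])

lemma C_generate: "generate C {hopf lam \<phi>} = range (\<lambda>n. restrict (deck n) Rt)"
proof -
  have "{hopf lam \<phi>} \<subseteq> affine ` carrier affine_group"
    unfolding hopf_eq affine_deck_param[of 1, symmetric] using deck_param_closed[of 1] by blast
  then show ?thesis
    unfolding C_eq using group.generate_consistent[OF group_BijGroup _ affine_image_subgroup] hopf_generate
    by simp
qed

section \<open>Lifting maps of the Reeb component\<close>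

abbreviation P where "P \<equiv> proj lam \<phi>"

definition is_lift ::
  "((complex \<times> real) set \<Rightarrow> (complex \<times> real) set) \<Rightarrow> (complex \<times> real \<Rightarrow> complex \<times> real) \<Rightarrow> bool" where
  "is_lift F G \<longleftrightarrow> continuous_on Rt G \<and> (\<forall>p\<in>Rt. G p \<in> Rt \<and> P (G p) = F (P p))"

lemma is_liftD:
  assumes "is_lift F G"
  shows "continuous_on Rt G" "\<And>p. p \<in> Rt \<Longrightarrow> G p \<in> Rt" "\<And>p. p \<in> Rt \<Longrightarrow> P (G p) = F (P p)"
  using assms by (auto simp: is_lift_def)

lemma P_Reeb: "p \<in> Rt \<Longrightarrow> P p \<in> Reeb lam \<phi>"
  by (simp add: Reeb_def)

lemma continuous_deck: "continuous_on Rt (deck n)"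
  by (rule smooth_on_imp_continuous_on[OF smooth_deck])

lemma openin_Rt_preimage:
  assumes "openin (top_of_set Rt) W" "continuous_on W g" "g ` W \<subseteq> Rt" "openin (top_of_set Rt) V"
  shows "openin (top_of_set Rt) {p \<in> W. g p \<in> V}"
proof -
  have "openin (top_of_set W) (W \<inter> g -` V)"
    using assms by (intro continuous_openin_preimage[where T = Rt]) auto
  then have "openin (top_of_set Rt) (W \<inter> g -` V)"
    using assms(1) openin_trans by blast
  then show ?thesis
    by (simp add: vimage_def Collect_conj_eq[symmetric] Int_def)
qed

text \<open>
  At every point the two maps differ by some power of the deck transformation, unique because the
  action is free.  The exponent is locally constant because orbits meet a chart at most once, and
  \<open>Rt\<close> is connected.
\<close>
lemma lifts_differ_by_deck:
  assumes f: "continuous_on Rt f" "\<And>p. p \<in> Rt \<Longrightarrow> f p \<in> Rt"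
    and g: "continuous_on Rt g" "\<And>p. p \<in> Rt \<Longrightarrow> g p \<in> Rt"
    and fg: "\<And>p. p \<in> Rt \<Longrightarrow> P (f p) = P (g p)"
  shows "\<exists>n. \<forall>p\<in>Rt. f p = deck n (g p)"
proof -
  define A where "A n = {p \<in> Rt. f p = deck n (g p)}" for n
  have op: "openin (top_of_set Rt) (A n)" for n
  proof (subst openin_subopen, rule)
    fix p assume "p \<in> A n"
    then have p: "p \<in> Rt" "f p = deck n (g p)" by (auto simp: A_def)
    obtain V where V: "openin (top_of_set Rt) V" "inj_on P V" "f p \<in> V"
      using ex_Reeb_chart[OF f(2)[OF p(1)]] by (auto simp: Reeb_chart_def)
    have "continuous_on Rt (\<lambda>p. deck n (g p))"
      by (rule continuous_on_compose2[OF continuous_deck g(1)]) (use g in auto)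
    then have "openin (top_of_set Rt) ({p \<in> Rt. f p \<in> V} \<inter> {p \<in> Rt. deck n (g p) \<in> V})"
      using f g V by (intro openin_Int openin_Rt_preimage) auto
    moreover have "{p \<in> Rt. f p \<in> V} \<inter> {p \<in> Rt. deck n (g p) \<in> V} \<subseteq> A n"
    proof (rule subsetI)
      fix q assume q: "q \<in> {p \<in> Rt. f p \<in> V} \<inter> {p \<in> Rt. deck n (g p) \<in> V}"
      then have "P (f q) = P (deck n (g q))"
        using fg[of q] g(2)[of q] by simp
      with q show "q \<in> A n"
        using inj_onD[OF V(2), of "f q" "deck n (g q)"] by (simp add: A_def)
    qed
    ultimately show "\<exists>U. openin (top_of_set Rt) U \<and> p \<in> U \<and> U \<subseteq> A n"
      using p V by (intro exI[of _ "{p \<in> Rt. f p \<in> V} \<inter> {p \<in> Rt. deck n (g p) \<in> V}"]) auto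
  qed
  have one: "(1, 1) \<in> Rt" by (simp add: Rt_iff)
  obtain n where n: "f (1, 1) = deck n (g (1, 1))"
    using proj_eq_iff[OF f(2)[OF one] g(2)[OF one]] fg[OF one] by auto
  have "\<exists>m. f p = deck m (g p)" if "p \<in> Rt" for p
    using proj_eq_iff[OF f(2)[OF that] g(2)[OF that]] fg[OF that] by auto
  then have ex: "\<exists>m. p \<in> A m" if "p \<in> Rt" for p
    using that by (simp add: A_def)
  have A_eq: "m = k" if "p \<in> A m" "p \<in> A k" for p m k
    using that deck_eq_iff[OF g(2), of p m k] by (simp add: A_def)
  have A_sub: "A m \<subseteq> Rt" for m
    by (simp add: A_def)
  have "Rt - A n = (\<Union>m\<in>-{n}. A m)"
  proof
    show "Rt - A n \<subseteq> (\<Union>m\<in>-{n}. A m)"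
    proof
      fix q assume q: "q \<in> Rt - A n"
      then obtain m where m: "q \<in> A m" using ex[of q] by auto
      with q have "m \<noteq> n" by auto
      with m show "q \<in> (\<Union>m\<in>-{n}. A m)" by auto
    qed
    show "(\<Union>m\<in>-{n}. A m) \<subseteq> Rt - A n"
    proof
      fix q assume "q \<in> (\<Union>m\<in>-{n}. A m)"
      then obtain m where m: "m \<noteq> n" "q \<in> A m" by auto
      then have "q \<notin> A n" using A_eq[of q m n] by metis
      then show "q \<in> Rt - A n" using m A_sub[of m] by auto
    qed
  qed
  then have "openin (top_of_set Rt) (Rt - A n)"
    using op by auto
  then have "closedin (top_of_set Rt) (A n)"
    by (auto simp: closedin_def A_def)
  then have "A n = {} \<or> A n = Rt"
    using connected_Rt op unfolding connected_clopen by blast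
  then show ?thesis
    using n one by (auto simp: A_def)
qed

subsection \<open>Local representations\<close>

text \<open>
  A map in charts given near some point of the orbit of \<open>p\<close> is carried to \<open>p\<close> itself by a power of
  the deck transformation.
\<close>
lemma local_representation:
  assumes F: "locally_in_charts lam \<phi> Q F" and p: "p \<in> Rt"
    and shift: "\<And>U s n. Q U s \<Longrightarrow> U \<subseteq> Rt \<Longrightarrow> Q (deck n ` U) (\<lambda>p. s (deck (- n) p))"
  obtains W V s where "openin (top_of_set Rt) W" "p \<in> W" "openin (top_of_set Rt) V" "inj_on P V"
    "s ` W \<subseteq> V" "\<And>p. p \<in> W \<Longrightarrow> P (s p) = F (P p)" "Q W s"
proof -
  obtain U V where U: "Reeb_chart lam \<phi> U" and V: "Reeb_chart lam \<phi> V" and "P p \<in> P ` U"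
    and FU: "F ` (P ` U) \<subseteq> P ` V" and Q: "Q U (in_charts lam \<phi> V F)"
    using bspec[OF F[unfolded locally_in_charts_def] P_Reeb[OF p]] by (elim exE conjE) rule
  from \<open>P p \<in> P ` U\<close> obtain u where u: "u \<in> U" "P p = P u" by blast
  have U_Rt: "U \<subseteq> Rt"
    using U openin_imp_subset unfolding Reeb_chart_def by blast
  then obtain k where k: "p = deck k u"
    using proj_eq_iff[of p u] u p by auto
  define s where "s = (\<lambda>p. in_charts lam \<phi> V F (deck (- k) p))"
  have s: "s (deck k u) \<in> V \<and> P (s (deck k u)) = F (P (deck k u))" if "u \<in> U" for u
  proof -
    have "F (P u) \<in> P ` V" using FU that by blast
    then show ?thesis
      using that U_Rt by (auto simp: s_def in_charts_def inv_into_into f_inv_into_f subsetD)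
  qed
  show thesis
  proof (rule that[of "deck k ` U" V s])
    show "openin (top_of_set Rt) (deck k ` U)"
      using U by (intro deck_open) (simp add: Reeb_chart_def)
    show "Q (deck k ` U) s"
      unfolding s_def by (rule shift[OF Q U_Rt])
  qed (use u k s V in \<open>auto simp: Reeb_chart_def\<close>)
qed

text \<open>
  Near \<open>p\<close> a local representation \<open>s\<close> of \<open>F\<close> takes values in a chart \<open>V\<close>, and so does a translate
  \<open>deck n \<circ> G\<close> of the lift; both represent \<open>F\<close>, so they agree.
\<close>
lemma lift_inherits_local_property:
  assumes F: "locally_in_charts lam \<phi> Q F" and G: "is_lift F G" and p: "p \<in> Rt"
    and shift: "\<And>U s n. Q U s \<Longrightarrow> U \<subseteq> Rt \<Longrightarrow> Q (deck n ` U) (\<lambda>p. s (deck (- n) p))"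
    and compose: "\<And>U s n. Q U s \<Longrightarrow> s ` U \<subseteq> Rt \<Longrightarrow> Q U (\<lambda>p. deck n (s p))"
    and subset: "\<And>U U' s. Q U s \<Longrightarrow> U' \<subseteq> U \<Longrightarrow> Q U' s"
    and cong: "\<And>U s s'. Q U s \<Longrightarrow> (\<And>p. p \<in> U \<Longrightarrow> s p = s' p) \<Longrightarrow> Q U s'"
  shows "\<exists>W. openin (top_of_set Rt) W \<and> p \<in> W \<and> Q W G"
proof -
  obtain W V s where W: "openin (top_of_set Rt) W" "p \<in> W" and V: "openin (top_of_set Rt) V" "inj_on P V"
    and s: "s ` W \<subseteq> V" "\<And>p. p \<in> W \<Longrightarrow> P (s p) = F (P p)" and Q: "Q W s"
    using local_representation[OF F p shift] by blast
  note G = is_liftD[OF G]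
  have W_Rt: "W \<subseteq> Rt" and V_Rt: "V \<subseteq> Rt"
    using W V openin_imp_subset by blast+
  have "s p \<in> Rt" "P (s p) = P (G p)"
    using s W W_Rt V_Rt G(3)[of p] by auto
  then obtain n where n: "s p = deck n (G p)"
    using proj_eq_iff[of "s p" "G p"] G(2)[OF p] by auto
  define W' where "W' = {q \<in> W. deck n (G q) \<in> V}"
  have "continuous_on W (\<lambda>q. deck n (G q))"
    by (rule continuous_on_compose2[OF continuous_deck continuous_on_subset[OF G(1) W_Rt]])
      (use W_Rt G in auto)
  then have "openin (top_of_set Rt) W'"
    unfolding W'_def using W V W_Rt G by (intro openin_Rt_preimage) auto
  moreover have "p \<in> W'"
    using n W s by (auto simp: W'_def)
  moreover have "Q W' G"
  proof (rule cong)
    show "Q W' (\<lambda>q. deck (- n) (s q))"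
      using s V_Rt by (intro compose subset[OF Q]) (auto simp: W'_def)
    show "deck (- n) (s q) = G q" if "q \<in> W'" for q
    proof -
      have q: "q \<in> W" "deck n (G q) \<in> V" "q \<in> Rt"
        using that W_Rt by (auto simp: W'_def)
      then have "s q = deck n (G q)"
        using inj_onD[OF V(2), of "s q" "deck n (G q)"] s G by auto
      then show ?thesis using G q by simp
    qed
  qed
  ultimately show ?thesis by blast
qed

lemma smooth_shift_deck:
  assumes "smooth_on U s" "U \<subseteq> Rt"
  shows "smooth_on (deck n ` U) (\<lambda>p. s (deck (- n) p))"
proof (rule smooth_on_compose[OF assms(1)])
  show "smooth_on (deck n ` U) (deck (- n))"
    by (rule smooth_on_subset[OF smooth_deck]) (use assms in auto)
qed (use assms in auto)

lemma smooth_compose_deck: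
  "smooth_on U s \<Longrightarrow> s ` U \<subseteq> Rt \<Longrightarrow> smooth_on U (\<lambda>p. deck n (s p))"
  by (rule smooth_on_compose[OF smooth_deck])

lemma smooth_lift:
  assumes "locally_in_charts lam \<phi> smooth_on F" "is_lift F G"
  shows "smooth_on Rt G"
proof (rule smooth_on_local[OF Rt_unique_derivatives])
  show "\<exists>W. openin (top_of_set Rt) W \<and> p \<in> W \<and> smooth_on W G" if "p \<in> Rt" for p
    using assms that smooth_shift_deck smooth_compose_deck smooth_on_subset smooth_on_cong
    by (rule lift_inherits_local_property)
qed

text \<open>
  This is the local part of \<^const>\<open>leafwise_holomorphic_on\<close>; that a slice goes to a single slice
  follows for lifts from \<open>lift_maps_leaf_into_leaf\<close>.
\<close>
definition slices_holomorphic ::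
  "(complex \<times> real) set \<Rightarrow> (complex \<times> real \<Rightarrow> complex \<times> real) \<Rightarrow> bool" where
  "slices_holomorphic U s \<longleftrightarrow> (\<forall>x. (\<lambda>z. fst (s (z, x))) holomorphic_on {z. (z, x) \<in> U})"

lemma holomorphic_lift:
  assumes "locally_in_charts lam \<phi> leafwise_holomorphic_on F" "is_lift F G"
  shows "slices_holomorphic Rt G"
proof -
  have F: "locally_in_charts lam \<phi> slices_holomorphic F"
    using assms(1) unfolding locally_in_charts_def leafwise_holomorphic_on_def slices_holomorphic_def
    by meson
  have loc: "\<exists>W. openin (top_of_set Rt) W \<and> p \<in> W \<and> slices_holomorphic W G" if "p \<in> Rt" for p
    using F assms(2) that
  proof (rule lift_inherits_local_property)
    show "slices_holomorphic (deck n ` U) (\<lambda>p. s (deck (- n) p))"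
      if s: "slices_holomorphic U s" and U: "U \<subseteq> Rt" for U s n
      unfolding slices_holomorphic_def
    proof
      fix x
      have "(\<lambda>z. fst (s (z, phi_pow (- n) x))) \<circ> (\<lambda>z. lam powi (- n) * z) holomorphic_on {z. (z, x) \<in> deck n ` U}"
      proof (rule holomorphic_on_compose_gen)
        show "(\<lambda>z. fst (s (z, phi_pow (- n) x))) holomorphic_on {z. (z, phi_pow (- n) x) \<in> U}"
          using s by (simp add: slices_holomorphic_def)
        show "(\<lambda>z. lam powi (- n) * z) ` {z. (z, x) \<in> deck n ` U} \<subseteq> {z. (z, phi_pow (- n) x) \<in> U}"
        proof (rule image_subsetI, rule CollectI)
          fix z assume "z \<in> {z. (z, x) \<in> deck n ` U}"
          then obtain u where u: "u \<in> U" "deck n u = (z, x)" by auto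
          then have "deck (- n) (z, x) = u"
            using U by (metis deck_neg_cancel(2) subsetD)
          then show "(lam powi (- n) * z, phi_pow (- n) x) \<in> U"
            using u by (simp add: deck_def)
        qed
      qed (intro holomorphic_intros)
      then show "(\<lambda>z. fst (s (deck (- n) (z, x)))) holomorphic_on {z. (z, x) \<in> deck n ` U}"
        by (simp add: deck_def o_def)
    qed
    show "slices_holomorphic U (\<lambda>p. deck n (s p))" if "slices_holomorphic U s" for U s n
    proof -
      have "fst (deck n q) = lam powi n * fst q" for q
        by (cases q) (simp add: deck_def)
      then show ?thesis
        using that by (auto simp: slices_holomorphic_def intro!: holomorphic_intros)
    qed
    show "slices_holomorphic U' s" if "slices_holomorphic U s" "U' \<subseteq> U" for U U' s
      unfolding slices_holomorphic_def
    proof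
      fix x
      show "(\<lambda>z. fst (s (z, x))) holomorphic_on {z. (z, x) \<in> U'}"
        by (rule holomorphic_on_subset[of _ "{z. (z, x) \<in> U}"])
          (use that in \<open>auto simp: slices_holomorphic_def\<close>)
    qed
    show "slices_holomorphic U s'" if "slices_holomorphic U s" "\<And>p. p \<in> U \<Longrightarrow> s p = s' p" for U s s'
      unfolding slices_holomorphic_def
    proof
      fix x
      show "(\<lambda>z. fst (s' (z, x))) holomorphic_on {z. (z, x) \<in> U}"
        by (rule holomorphic_transform[of "\<lambda>z. fst (s (z, x))"])
          (use that in \<open>auto simp: slices_holomorphic_def\<close>)
    qed
  qed
  show ?thesis
    unfolding slices_holomorphic_def
  proof
    fix x
    have "(\<lambda>z. fst (G (z, x))) field_differentiable at z within {z. (z, x) \<in> Rt}"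
      if z: "(z, x) \<in> Rt" for z
    proof -
      obtain W where W: "openin (top_of_set Rt) W" "(z, x) \<in> W" "slices_holomorphic W G"
        using loc[OF z] by blast
      obtain O' where O': "open O'" "W = Rt \<inter> O'"
        using W(1) by (auto simp: openin_open)
      have "open {z. (z, x) \<in> Rt}"
      proof (cases "x \<le> 0")
        case True
        then have "{z::complex. (z, x) \<in> Rt} = {} \<or> {z. (z, x) \<in> Rt} = - {0}"
          by (auto simp: Rt_iff)
        then show ?thesis by (metis open_Compl closed_singleton open_empty)
      qed (auto simp: Rt_iff)
      moreover have "open ((\<lambda>z. (z, x)) -` O')"
        by (intro open_vimage O' continuous_intros)
      ultimately have "open {z. (z, x) \<in> W}"
        unfolding O'(2) by (simp add: vimage_def open_Collect_conj)
      then have "(\<lambda>z. fst (G (z, x))) field_differentiable at z"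
        using W by (intro holomorphic_on_imp_differentiable_at[of _ "{z. (z, x) \<in> W}"])
          (auto simp: slices_holomorphic_def)
      then show ?thesis
        by (rule field_differentiable_at_within)
    qed
    then show "(\<lambda>z. fst (G (z, x))) holomorphic_on {z. (z, x) \<in> Rt}"
      by (simp add: holomorphic_on_def)
  qed
qed

subsection \<open>Existence of lifts\<close>

text \<open>
  A lift of \<open>F\<close> is the same as a section of the covering \<open>E\<close> of \<open>Rt\<close> that is pulled back along
  \<open>F \<circ> P\<close>, and \<open>E\<close> is a set of pairs of points of \<open>Rt\<close>, which lives in a Euclidean space unlike the
  quotient.  Over the domain of a local representation \<open>s\<close> the sheets of \<open>E\<close> are the graphs of the maps
  \<open>deck n \<circ> s\<close>.  As \<open>Rt\<close> is simply connected, its identity map lifts to \<open>E\<close>.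
\<close>
lemma ex_lift:
  assumes FR: "\<And>q. q \<in> Reeb lam \<phi> \<Longrightarrow> F q \<in> Reeb lam \<phi>"
    and F: "locally_in_charts lam \<phi> smooth_on F"
  shows "\<exists>G. is_lift F G"
proof -
  define E where "E = {(p, q). p \<in> Rt \<and> q \<in> Rt \<and> P q = F (P p)}"
  have "covering_space E fst Rt"
  proof
    show "continuous_on E fst" by (intro continuous_intros)
    have "p \<in> fst ` E" if p: "p \<in> Rt" for p
    proof -
      obtain q where "q \<in> Rt" "P q = F (P p)"
        using FR[OF P_Reeb[OF p]] unfolding Reeb_def by (metis imageE)
      then have "(p, q) \<in> E" using p by (simp add: E_def)
      then show ?thesis by force
    qed
    then show "fst ` E = Rt"
      by (auto simp: E_def)
    fix p assume p: "p \<in> Rt"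
    obtain W V s where W: "openin (top_of_set Rt) W" "p \<in> W" and V: "openin (top_of_set Rt) V" "inj_on P V"
      and s: "s ` W \<subseteq> V" "\<And>p. p \<in> W \<Longrightarrow> P (s p) = F (P p)" and smooth: "smooth_on W s"
      using local_representation[OF F p smooth_shift_deck] by blast
    have W_Rt: "W \<subseteq> Rt" and V_Rt: "V \<subseteq> Rt"
      using W V openin_imp_subset by blast+
    have s_Rt: "s p' \<in> Rt" if "p' \<in> W" for p'
      using that s V_Rt by blast
    define sheet where "sheet n = (\<lambda>p'. (p', deck n (s p'))) ` W" for n
    have sheet_eq: "sheet n = E \<inter> (W \<times> deck n ` V)" for n
    proof
      show "sheet n \<subseteq> E \<inter> (W \<times> deck n ` V)"
        using W_Rt s s_Rt by (auto simp: sheet_def E_def)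
      show "E \<inter> (W \<times> deck n ` V) \<subseteq> sheet n"
      proof
        fix e assume "e \<in> E \<inter> (W \<times> deck n ` V)"
        then obtain p' v where e: "e = (p', deck n v)" "p' \<in> W" "v \<in> V" "P (deck n v) = F (P p')"
          by (auto simp: E_def)
        then have "P v = P (s p')"
          using s V_Rt by auto
        then have "v = s p'"
          using e s by (intro inj_onD[OF V(2)]) auto
        then show "e \<in> sheet n"
          using e by (auto simp: sheet_def)
      qed
    qed
    have sheets: "\<Union>(range sheet) = E \<inter> fst -` W"
    proof
      show "\<Union>(range sheet) \<subseteq> E \<inter> fst -` W"
        unfolding sheet_eq by auto
      show "E \<inter> fst -` W \<subseteq> \<Union>(range sheet)"
      proof
        fix e assume "e \<in> E \<inter> fst -` W"
        then obtain p' q where e: "e = (p', q)" "p' \<in> W" "q \<in> Rt" "P q = P (s p')"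
          using s by (auto simp: E_def)
        then obtain n where "q = deck n (s p')"
          using proj_eq_iff[OF e(3) s_Rt[OF e(2)]] by auto
        then show "e \<in> \<Union>(range sheet)"
          using e by (auto simp: sheet_def)
      qed
    qed
    have open_sheet: "openin (top_of_set E) (sheet n)" for n
    proof -
      obtain O1 where O1: "open O1" "W = Rt \<inter> O1"
        using W(1) by (auto simp: openin_open)
      obtain O2 where O2: "open O2" "deck n ` V = Rt \<inter> O2"
        using deck_open[OF V(1)] by (auto simp: openin_open)
      have "sheet n = E \<inter> (O1 \<times> O2)"
        unfolding sheet_eq O1 O2 by (auto simp: E_def)
      then show ?thesis
        using O1 O2 by (simp add: openin_open_Int open_Times)
    qed
    have disj: "pairwise disjnt (range sheet)"
    proof (rule pairwiseI)
      fix A B assume "A \<in> range sheet" "B \<in> range sheet" "A \<noteq> B"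
      then show "disjnt A B"
        using deck_eq_iff[OF s_Rt] by (auto simp: sheet_def disjnt_def)
    qed
    have homeo: "homeomorphism (sheet n) W fst (\<lambda>p'. (p', deck n (s p')))" for n
    proof -
      have "continuous_on W (\<lambda>p'. deck n (s p'))"
        by (rule continuous_on_compose2[OF continuous_deck smooth_on_imp_continuous_on[OF smooth]])
          (use s_Rt in auto)
      then show ?thesis
        by (auto simp: homeomorphism_def sheet_def image_image intro!: continuous_intros)
    qed
    show "\<exists>W. p \<in> W \<and> openin (top_of_set Rt) W \<and>
        (\<exists>v. \<Union>v = E \<inter> fst -` W \<and> (\<forall>u\<in>v. openin (top_of_set E) u) \<and> pairwise disjnt v \<and>
          (\<forall>u\<in>v. \<exists>q. homeomorphism u W fst q))"
    proof (intro exI[of _ W] conjI exI[of _ "range sheet"] ballI)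
      show "openin (top_of_set E) u" "\<exists>q. homeomorphism u W fst q" if "u \<in> range sheet" for u
        using that open_sheet homeo by blast+
    qed (rule W sheets disj)+
  qed
  then obtain g where g: "continuous_on Rt g" "g \<in> Rt \<rightarrow> E" "\<And>p. p \<in> Rt \<Longrightarrow> fst (g p) = p"
    by (rule covering_space_lift[OF _ starlike_imp_simply_connected[OF starlike_Rt]
          locally_path_connected_Rt continuous_on_id, of E fst]) auto
  have "snd (g p) \<in> Rt \<and> P (snd (g p)) = F (P p)" if "p \<in> Rt" for p
  proof -
    have "g p \<in> E" "fst (g p) = p" using g(2,3) that by auto
    then show ?thesis by (cases "g p") (simp add: E_def)
  qed
  then have "is_lift F (\<lambda>p. snd (g p))"
    using g(1) by (auto simp: is_lift_def intro: continuous_on_snd)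
  then show ?thesis by blast
qed

subsection \<open>Lifts of automorphisms\<close>

text \<open>
  Lifts of \<open>F\<close> and of its inverse compose to powers of the deck transformation, and one of these
  powers can be absorbed into the second lift.
\<close>
lemma ex_lift_pair:
  assumes F: "F \<in> Bij (Reeb lam \<phi>)" and smooth: "locally_in_charts lam \<phi> smooth_on F"
    "locally_in_charts lam \<phi> smooth_on (inv_into (Reeb lam \<phi>) F)"
  obtains G G' where "is_lift F G" "is_lift (inv_into (Reeb lam \<phi>) F) G'"
    "\<And>p. p \<in> Rt \<Longrightarrow> G (G' p) = p" "\<And>p. p \<in> Rt \<Longrightarrow> G' (G p) = p"
proof -
  let ?F' = "inv_into (Reeb lam \<phi>) F"
  obtain G where G: "is_lift F G"
    using ex_lift[OF Bij_app[OF F] smooth(1)] by blast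
  obtain H where H: "is_lift ?F' H"
    using ex_lift[OF Bij_inv_into(1)[OF F] smooth(2)] by blast
  note G' = is_liftD[OF G] and H' = is_liftD[OF H]
  have "\<exists>n. \<forall>p\<in>Rt. G (H p) = deck n p"
  proof (rule lifts_differ_by_deck)
    show "continuous_on Rt (\<lambda>p. G (H p))"
      by (rule continuous_on_compose2[OF G'(1) H'(1)]) (use H' in auto)
    show "P (G (H p)) = P p" if "p \<in> Rt" for p
      using that G' H' Bij_inv_into(2)[OF F P_Reeb] by simp
  qed (use G' H' in auto)
  then obtain n where n: "\<And>p. p \<in> Rt \<Longrightarrow> G (H p) = deck n p" by blast
  have "\<exists>m. \<forall>p\<in>Rt. H (G p) = deck m p"
  proof (rule lifts_differ_by_deck)
    show "continuous_on Rt (\<lambda>p. H (G p))"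
      by (rule continuous_on_compose2[OF H'(1) G'(1)]) (use G' in auto)
    show "P (H (G p)) = P p" if "p \<in> Rt" for p
      using that G' H' Bij_inv_into(3)[OF F P_Reeb] by simp
  qed (use G' H' in auto)
  then obtain m where m: "\<And>p. p \<in> Rt \<Longrightarrow> H (G p) = deck m p" by blast
  define J where "J = (\<lambda>p. H (deck (- n) p))"
  have J: "is_lift ?F' J"
    unfolding is_lift_def J_def using H'
    by (auto intro!: continuous_on_compose2[OF H'(1) continuous_deck])
  have GJ: "G (J p) = p" if "p \<in> Rt" for p
    using that n by (simp add: J_def)
  moreover have "J (G p) = p" if "p \<in> Rt" for p
  proof -
    have "deck m (J (G p)) = H (G (J (G p)))"
      using m[OF is_liftD(2)[OF J]] G' that by simp
    also have "\<dots> = deck m p"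
      using GJ[of "G p"] G' m that by simp
    finally show ?thesis
      using deck_inj[OF is_liftD(2)[OF J]] G' that by simp
  qed
  ultimately show thesis
    using that G J by blast
qed

lemma lift_intertwines:
  assumes "is_lift F G"
  shows "\<exists>k. \<forall>p\<in>Rt. G (deck 1 p) = deck k (G p)"
proof (rule lifts_differ_by_deck)
  note G = is_liftD[OF assms]
  show "continuous_on Rt (\<lambda>p. G (deck 1 p))"
    by (rule continuous_on_compose2[OF G(1) continuous_deck]) auto
  show "P (G (deck 1 p)) = P (G p)" if "p \<in> Rt" for p
    using that G by simp
qed (use is_liftD[OF assms] in auto)

lemma leaf_Rt: "0 \<le> x \<Longrightarrow> leaf x \<subseteq> Rt"
  by (auto simp: leaf_iff)

lemma one_leaf: "0 \<le> x \<Longrightarrow> (1, x) \<in> leaf x" "0 \<le> x \<Longrightarrow> (1, x) \<in> Rt"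
  by (auto simp: leaf_iff Rt_iff)

lemma snd_leaf: "0 \<le> x \<Longrightarrow> p \<in> leaf x \<Longrightarrow> snd p = x"
  by (cases p) (simp add: leaf_iff)

lemma leafI: "p \<in> Rt \<Longrightarrow> p \<in> leaf (snd p)" "p \<in> Rt \<Longrightarrow> 0 \<le> snd p"
  by (cases p; auto simp: leaf_def Rt_iff)+

lemma connected_leaf: "connected (leaf x)"
proof -
  have "connected (UNIV - {0::complex})"
    using connected_punctured_universe[of "0::complex"] by (simp add: Compl_eq_Diff_UNIV)
  then show ?thesis
    by (auto simp: leaf_def intro: connected_Times connected_UNIV)
qed

lemma leaves_Reeb_iff: "S \<in> leaves_Reeb lam \<phi> \<longleftrightarrow> (\<exists>x\<ge>0. S = P ` leaf x)"
  by (auto simp: leaves_Reeb_def leaves_Rt_def)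

text \<open>
  Two leaves of the covering space whose images meet are translates of each other.
\<close>
lemma P_leaf_eq:
  assumes "0 \<le> x" "0 \<le> y" "q \<in> P ` leaf x" "q \<in> P ` leaf y"
  shows "P ` leaf x = P ` leaf y"
proof -
  obtain u w where uw: "u \<in> leaf x" "w \<in> leaf y" "P u = P w"
    using assms(3,4) by auto
  have Rt: "u \<in> Rt" "w \<in> Rt" using uw assms leaf_Rt by blast+
  then obtain n where n: "u = deck n w"
    using proj_eq_iff uw(3) by auto
  then have x: "x = phi_pow n y"
    using snd_leaf[OF assms(1) uw(1)] snd_leaf[OF assms(2) uw(2)] by (cases w) (simp add: deck_def)
  have "leaf x = affine (deck_param n) ` leaf y"
    using affine_leaf[of _ _ _ y] deck_param_closed[of n] assms(2) by (simp add: deck_param_def x)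
  also have "\<dots> = deck n ` leaf y"
    unfolding affine_deck_param using leaf_Rt[OF assms(2)] by (intro image_cong) auto
  finally have "P ` leaf x = (\<lambda>p. P (deck n p)) ` leaf y"
    by (simp add: image_image)
  also have "\<dots> = P ` leaf y"
    using leaf_Rt[OF assms(2)] by (intro image_cong) auto
  finally show ?thesis .
qed

text \<open>
  Leaves partition the Reeb component: the image of the leaf through a preimage of a point of \<open>S\<close> is
  a leaf that meets \<open>S\<close>, so it is \<open>S\<close>.
\<close>
lemma inverse_preserves_leaves:
  assumes F: "F \<in> Bij (Reeb lam \<phi>)"
    and leaves: "\<And>S. S \<in> leaves_Reeb lam \<phi> \<Longrightarrow> F ` S \<in> leaves_Reeb lam \<phi>"
    and S: "S \<in> leaves_Reeb lam \<phi>"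
  shows "inv_into (Reeb lam \<phi>) F ` S \<in> leaves_Reeb lam \<phi>"
proof -
  obtain y where y: "0 \<le> y" "S = P ` leaf y"
    using S by (auto simp: leaves_Reeb_iff)
  let ?q = "P (1, y)"
  have q: "?q \<in> S" "?q \<in> Reeb lam \<phi>"
    using y one_leaf P_Reeb by auto
  obtain p where p: "p \<in> Rt" "inv_into (Reeb lam \<phi>) F ?q = P p"
    using Bij_inv_into(1)[OF F q(2)] by (auto simp: Reeb_def)
  have "?q = F (P p)"
    using Bij_inv_into(2)[OF F q(2)] p(2) by simp
  then have "?q \<in> F ` P ` leaf (snd p)"
    using leafI[OF p(1)] by blast
  moreover have leaf: "P ` leaf (snd p) \<in> leaves_Reeb lam \<phi>"
    using leafI[OF p(1)] by (auto simp: leaves_Reeb_iff)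
  then obtain x where "0 \<le> x" "F ` P ` leaf (snd p) = P ` leaf x"
    using leaves leaves_Reeb_iff by metis
  ultimately have eq: "S = F ` P ` leaf (snd p)"
    using P_leaf_eq[of x y ?q] q y by auto
  have "P ` leaf (snd p) \<subseteq> Reeb lam \<phi>"
    using leaf_Rt[OF leafI(2)[OF p(1)]] P_Reeb by blast
  then have "inv_into (Reeb lam \<phi>) F ` S = P ` leaf (snd p)"
    unfolding eq using F by (intro inv_into_image_cancel) (auto simp: Bij_def bij_betw_def)
  then show ?thesis using leaf by simp
qed

text \<open>
  The heights of points over one leaf of the Reeb component form a \<open>\<phi>\<close>-orbit, a countable set.  The
  image of a leaf under a lift is connected, so it has a single height.
\<close>
lemma lift_maps_leaf_into_leaf:
  assumes G: "is_lift F G"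
    and leaves: "\<And>S. S \<in> leaves_Reeb lam \<phi> \<Longrightarrow> F ` S \<in> leaves_Reeb lam \<phi>"
    and x: "0 \<le> x" and p: "p \<in> leaf x"
  shows "G p \<in> leaf (snd (G (1, x)))"
proof -
  note G' = is_liftD[OF G]
  obtain y where y: "0 \<le> y" "F ` P ` leaf x = P ` leaf y"
    using leaves[of "P ` leaf x"] x unfolding leaves_Reeb_iff by blast
  have "snd (G q) \<in> range (\<lambda>n. phi_pow n y)" if q: "q \<in> leaf x" for q
  proof -
    have q_Rt: "q \<in> Rt" using leaf_Rt x q by blast
    have "P (G q) \<in> P ` leaf y"
      using y(2) q G'(3)[OF q_Rt] by blast
    then obtain w where w: "w \<in> leaf y" "P (G q) = P w" by auto
    then obtain n where "G q = deck n w"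
      using proj_eq_iff[OF G'(2)[OF q_Rt], of w] leaf_Rt y by blast
    then have "snd (G q) = phi_pow n y"
      using snd_leaf[OF y(1) w(1)] by (cases w) (simp add: deck_def)
    then show ?thesis by blast
  qed
  then have "(\<lambda>q. snd (G q)) ` leaf x \<subseteq> range (\<lambda>n. phi_pow n y)" by blast
  then have "countable ((\<lambda>q. snd (G q)) ` leaf x)"
    by (rule countable_subset) simp
  moreover have "connected ((\<lambda>q. snd (G q)) ` leaf x)"
    using G'(1) leaf_Rt[OF x]
    by (intro connected_continuous_image connected_leaf continuous_on_snd)
      (rule continuous_on_subset)
  ultimately have "snd (G p) = snd (G (1, x))"
    using connected_uncountable[of _ "snd (G p)" "snd (G (1, x))"] p one_leaf(1)[OF x] by blast
  then show ?thesis
    using leafI(1)[OF G'(2), of p] leaf_Rt[OF x] p by auto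
qed

text \<open>
  The map \<open>\<eta>\<close> induced on heights is an increasing injection with \<open>\<eta> 0 = 0\<close> and
  \<open>\<eta> \<circ> \<phi> = \<phi>\<^sup>k \<circ> \<eta>\<close>.  Since \<open>\<phi> 1 > 1\<close>, the power \<open>\<phi>\<^sup>k\<close> moves \<open>\<eta> 1\<close> upwards, so \<open>k > 0\<close>.
\<close>
lemma intertwining_exponent_pos:
  assumes G: "continuous_on Rt G" "\<And>p. p \<in> Rt \<Longrightarrow> G p \<in> Rt"
    and G': "\<And>p. p \<in> Rt \<Longrightarrow> G' (G p) = p"
    and leaf: "\<And>x p. 0 \<le> x \<Longrightarrow> p \<in> leaf x \<Longrightarrow> G p \<in> leaf (snd (G (1, x)))"
    and leaf': "\<And>x p. 0 \<le> x \<Longrightarrow> p \<in> leaf x \<Longrightarrow> G' p \<in> leaf (snd (G' (1, x)))"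
      "\<And>p. p \<in> Rt \<Longrightarrow> G' p \<in> Rt"
    and k: "\<And>p. p \<in> Rt \<Longrightarrow> G (deck 1 p) = deck k (G p)" "k \<noteq> 0"
  shows "0 < k"
proof -
  define \<eta> where "\<eta> = (\<lambda>x. snd (G (1, x)))"
  define \<zeta> where "\<zeta> = (\<lambda>x. snd (G' (1, x)))"
  have nonneg: "0 \<le> \<eta> x" "0 \<le> \<zeta> x" if "0 \<le> x" for x
    using leafI(2)[OF G(2)[OF one_leaf(2)[OF that]]] leafI(2)[OF leaf'(2)[OF one_leaf(2)[OF that]]]
    by (simp_all add: \<eta>_def \<zeta>_def)
  have "\<zeta> (\<eta> x) = x" if x: "0 \<le> x" for x
  proof -
    have "G (1, x) \<in> leaf (\<eta> x)"
      using leaf[OF x one_leaf(1)[OF x]] by (simp add: \<eta>_def)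
    then have "G' (G (1, x)) \<in> leaf (\<zeta> (\<eta> x))"
      using leaf'(1)[OF nonneg(1)[OF x]] by (simp add: \<zeta>_def)
    then show ?thesis
      using G'[OF one_leaf(2)[OF x]] snd_leaf[OF nonneg(2)[OF nonneg(1)[OF x]]] by fastforce
  qed
  then have inj: "inj_on \<eta> {0..}"
    by (intro inj_on_inverseI[where g = \<zeta>]) auto
  have eta_phi: "\<eta> (\<phi> x) = phi_pow k (\<eta> x)" if x: "0 \<le> x" for x
  proof -
    have "G (lam, \<phi> x) \<in> leaf (\<eta> (\<phi> x))"
      using leaf[of "\<phi> x" "(lam, \<phi> x)"] phi_nonneg[OF x] by (simp add: \<eta>_def leaf_iff Rt_iff)
    moreover have "G (lam, \<phi> x) = deck k (G (1, x))"
      using k(1)[OF one_leaf(2)[OF x]] by (simp add: deck_def)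
    ultimately have "snd (deck k (G (1, x))) = \<eta> (\<phi> x)"
      using snd_leaf[OF nonneg(1)[OF phi_nonneg[OF x]]] by simp
    moreover have "snd (deck k (G (1, x))) = phi_pow k (\<eta> x)"
      by (cases "G (1, x)") (simp add: deck_def \<eta>_def)
    ultimately show ?thesis by simp
  qed
  have cont: "continuous_on {0..} \<eta>"
    unfolding \<eta>_def
    by (intro continuous_on_snd continuous_on_compose2[OF G(1)] continuous_intros) (auto simp: Rt_iff)
  have "\<eta> 0 = 0"
  proof (rule ccontr)
    assume "\<eta> 0 \<noteq> 0"
    then have "0 < \<eta> 0" using nonneg[of 0] by simp
    moreover have "phi_pow k (\<eta> 0) = \<eta> 0" using eta_phi[of 0] by simp
    ultimately show False using phi_pow_fixed_iff k(2) by blast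
  qed
  note mono = half_line_strict_mono[OF cont inj this nonneg(1)]
  have "\<eta> 1 < phi_pow k (\<eta> 1)"
    using mono[of 1 "\<phi> 1"] phi_gt[of 1] eta_phi[of 1] by simp
  moreover have "phi_pow k (\<eta> 1) \<le> \<eta> 1" if "k \<le> 0"
    using phi_pow_ge[of "phi_pow k (\<eta> 1)" "- k"] nonneg[of 1] that by simp
  ultimately show "0 < k" by linarith
qed

text \<open>
  The exponents \<open>k\<close> and \<open>k'\<close> of a lift and of its inverse satisfy \<open>k * k' = 1\<close>, and both are
  positive.  So the lift commutes with the deck transformation, and \<open>automorphism_structure\<close> applies.
\<close>
lemma ex_equivariant_lift:
  assumes F: "F \<in> carrier (Aut_Reeb lam \<phi>)"
  obtains l where "l \<in> carrier affine_group" "\<And>p. p \<in> Rt \<Longrightarrow> P (affine l p) = F (P p)"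
proof -
  let ?F' = "inv_into (Reeb lam \<phi>) F"
  have Bij: "F \<in> Bij (Reeb lam \<phi>)"
    and smooth: "locally_in_charts lam \<phi> smooth_on F" "locally_in_charts lam \<phi> smooth_on ?F'"
    and leaves: "\<And>S. S \<in> leaves_Reeb lam \<phi> \<Longrightarrow> F ` S \<in> leaves_Reeb lam \<phi>"
    and hol: "locally_in_charts lam \<phi> leafwise_holomorphic_on F"
    using F by (auto simp: Aut_Reeb_def)
  obtain G G' where G: "is_lift F G" and G': "is_lift ?F' G'"
    and inv: "\<And>p. p \<in> Rt \<Longrightarrow> G (G' p) = p" "\<And>p. p \<in> Rt \<Longrightarrow> G' (G p) = p"
    using ex_lift_pair[OF Bij smooth] by blast
  note GD = is_liftD[OF G] and GD' = is_liftD[OF G']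
  have leaf: "G p \<in> leaf (snd (G (1, x)))" if "0 \<le> x" "p \<in> leaf x" for x p
    using lift_maps_leaf_into_leaf[OF G leaves] that by blast
  have leaf': "G' p \<in> leaf (snd (G' (1, x)))" if "0 \<le> x" "p \<in> leaf x" for x p
    using lift_maps_leaf_into_leaf[OF G' inverse_preserves_leaves[OF Bij leaves]] that by blast
  obtain k where k: "\<And>p. p \<in> Rt \<Longrightarrow> G (deck 1 p) = deck k (G p)"
    using lift_intertwines[OF G] by blast
  obtain k' where k': "\<And>p. p \<in> Rt \<Longrightarrow> G' (deck 1 p) = deck k' (G' p)"
    using lift_intertwines[OF G'] by blast
  have "deck (k * k') (1, 0) = G (deck k' (G' (1, 0)))"
    using commute_deck_powers[where F = G and k = k and p = "G' (1, 0)" and n = k']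
      GD(2) k GD'(2) inv(1)[of "(1, 0)"] one_leaf(2)[of 0] by simp
  also have "\<dots> = deck 1 (1, 0)"
    using k'[of "(1, 0)"] inv(1)[of "deck 1 (1, 0)"] one_leaf(2)[of 0] by simp
  finally have kk: "k * k' = 1"
    using deck_eq_iff one_leaf(2)[of 0] by blast
  then have nz: "k \<noteq> 0" "k' \<noteq> 0" by auto
  have "0 < k"
    by (rule intertwining_exponent_pos[OF GD(1,2) inv(2) leaf leaf' GD'(2) k nz(1)])
  moreover have "0 < k'"
    by (rule intertwining_exponent_pos[OF GD'(1,2) inv(1) leaf' leaf GD(2) k' nz(2)])
  ultimately have "k = 1"
    using kk zmult_eq_1_iff by auto
  have leaf_eq: "G ` leaf x = leaf (snd (G (1, x)))" if x: "0 \<le> x" for x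
  proof
    show "G ` leaf x \<subseteq> leaf (snd (G (1, x)))" using leaf[OF x] by blast
    let ?y = "snd (G (1, x))"
    have y: "0 \<le> ?y" using leafI(2) GD(2) one_leaf(2)[OF x] by blast
    have y': "0 \<le> snd (G' (1, ?y))" using leafI(2) GD'(2) one_leaf(2)[OF y] by blast
    have "(1, x) \<in> leaf (snd (G' (1, ?y)))"
      using leaf'[OF y leaf[OF x one_leaf(1)[OF x]]] inv(2)[OF one_leaf(2)[OF x]] by simp
    then have "snd (G' (1, ?y)) = x"
      using snd_leaf[OF y', of "(1, x)"] by simp
    then have "G' ` leaf ?y \<subseteq> leaf x"
      using leaf'[OF y] by (metis image_subsetI)
    show "leaf ?y \<subseteq> G ` leaf x"
    proof
      fix q assume q: "q \<in> leaf ?y"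
      then have "q = G (G' q)" using inv(1)[of q] leaf_Rt[OF y] by auto
      then show "q \<in> G ` leaf x" using q \<open>G' ` leaf ?y \<subseteq> leaf x\<close> by blast
    qed
  qed
  have "\<exists>l\<in>carrier affine_group. restrict G Rt = affine l"
  proof (rule automorphism_structure)
    show "restrict G Rt \<in> Bij Rt"
      by (rule Bij_restrictI[where g = G']) (use GD GD' inv in auto)
    show "smooth_on Rt (restrict G Rt)"
      by (rule smooth_on_cong[OF smooth_lift[OF smooth(1) G]]) simp
    show "smooth_on Rt (inv_into Rt (restrict G Rt))"
    proof (rule smooth_on_cong[OF smooth_lift[OF smooth(2) G']])
      show "G' p = inv_into Rt (restrict G Rt) p" if "p \<in> Rt" for p
        by (rule inv_into_restrict_eq[symmetric]) (use that GD GD' inv in auto)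
    qed
    show "restrict G Rt ` S \<in> leaves_Rt" if "S \<in> leaves_Rt" for S
    proof -
      obtain x where x: "0 \<le> x" "S = leaf x" using \<open>S \<in> leaves_Rt\<close> by (auto simp: leaves_Rt_def)
      have "restrict G Rt ` S = G ` leaf x"
        unfolding x(2) using leaf_Rt[OF x(1)] by (intro image_cong) auto
      moreover have "0 \<le> snd (G (1, x))" using leafI(2) GD(2) one_leaf(2)[OF x(1)] by blast
      ultimately show ?thesis
        using leaf_eq[OF x(1)] by (auto simp: leaves_Rt_def)
    qed
    show "leafwise_holomorphic_on Rt (restrict G Rt)"
      unfolding leafwise_holomorphic_on_def
    proof (intro allI conjI)
      fix x
      show "\<exists>y. \<forall>z. (z, x) \<in> Rt \<longrightarrow> snd (restrict G Rt (z, x)) = y"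
      proof (intro exI allI impI)
        fix z assume z: "(z, x) \<in> Rt"
        then have x: "0 \<le> x" by (simp add: Rt_iff)
        have "G (z, x) \<in> leaf (snd (G (1, x)))"
          using leaf[OF x, of "(z, x)"] z x by (simp add: leaf_iff)
        moreover have "0 \<le> snd (G (1, x))" using leafI(2) GD(2) one_leaf(2)[OF x] by blast
        ultimately show "snd (restrict G Rt (z, x)) = snd (G (1, x))"
          using z snd_leaf by simp
      qed
      show "(\<lambda>z. fst (restrict G Rt (z, x))) holomorphic_on {z. (z, x) \<in> Rt}"
        by (rule holomorphic_transform[of "\<lambda>z. fst (G (z, x))"])
          (use holomorphic_lift[OF hol G] in \<open>auto simp: slices_holomorphic_def\<close>)
    qed
    show "restrict G Rt (deck 1 p) = deck 1 (restrict G Rt p)" if "p \<in> Rt" for p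
      using k[OF that] that by (simp add: \<open>k = 1\<close>)
  qed
  then obtain l where l: "l \<in> carrier affine_group" "restrict G Rt = affine l" by blast
  have "P (affine l p) = F (P p)" if "p \<in> Rt" for p
    using that GD(3)[OF that] by (simp flip: l(2))
  with l show thesis using that by blast
qed

section \<open>Descent to the Reeb component\<close>

definition desc :: "(complex \<times> real \<Rightarrow> complex \<times> real) \<Rightarrow> (complex \<times> real) set \<Rightarrow> (complex \<times> real) set" where
  "desc F = (\<lambda>q\<in>Reeb lam \<phi>. F ` q)"

abbreviation desc_affine where "desc_affine l \<equiv> desc (affine l)"

lemma Reeb_cases:
  assumes "q \<in> Reeb lam \<phi>"
  obtains p where "p \<in> Rt" "q = P p"
  using assms by (auto simp: Reeb_def)

text \<open>
  A point of the Reeb component is an orbit, and a map that commutes with the deck transformation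
  sends the orbit of \<open>p\<close> to the orbit of its image.
\<close>
lemma desc_P:
  assumes l: "l \<in> carrier affine_group" and p: "p \<in> Rt"
  shows "desc_affine l (P p) = P (affine l p)"
proof -
  have "affine l (deck n p) = deck n (affine l p)" for n
    using commute_deck_powers[where F = "affine l" and k = 1 and p = p and n = n] affine_Rt[OF l] affine_commute[OF l] p
    by simp
  then have "affine l ` range (\<lambda>n. deck n p) = range (\<lambda>n. deck n (affine l p))"
    by (simp add: image_image)
  then show ?thesis
    using restrict_apply'[OF P_Reeb[OF p], of "(`) (affine l)"]
    by (simp add: desc_def proj_eq[OF p] proj_eq[OF affine_Rt[OF l p]])
qed

lemma desc_Reeb:
  "l \<in> carrier affine_group \<Longrightarrow> q \<in> Reeb lam \<phi> \<Longrightarrow> desc_affine l q \<in> Reeb lam \<phi>"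
  by (elim Reeb_cases) (simp add: desc_P affine_Rt P_Reeb)

lemma desc_inverse:
  assumes "l \<in> carrier affine_group" "q \<in> Reeb lam \<phi>"
  shows "desc_affine (inv\<^bsub>affine_group\<^esub> l) (desc_affine l q) = q" "desc_affine l (desc_affine (inv\<^bsub>affine_group\<^esub> l) q) = q"
  using assms by (elim Reeb_cases, simp add: desc_P affine_Rt affine_inverse)+

lemma desc_restrict: "desc F = restrict (desc F) (Reeb lam \<phi>)"
  by (simp add: desc_def)

lemma desc_Bij: "l \<in> carrier affine_group \<Longrightarrow> desc_affine l \<in> Bij (Reeb lam \<phi>)"
  by (subst desc_restrict) (rule Bij_restrictI[where g = "desc_affine (inv\<^bsub>affine_group\<^esub> l)"]; simp add: desc_Reeb desc_inverse)

lemma inv_into_desc: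
  "l \<in> carrier affine_group \<Longrightarrow> q \<in> Reeb lam \<phi> \<Longrightarrow> inv_into (Reeb lam \<phi>) (desc_affine l) q = desc_affine (inv\<^bsub>affine_group\<^esub> l) q"
  by (subst (1) desc_restrict) (rule inv_into_restrict_eq; simp add: desc_Reeb desc_inverse)

text \<open>
  In small charts around \<open>p\<close> and around its image, the induced map is the given map itself.
\<close>
lemma descent_locally_in_charts:
  assumes l: "l \<in> carrier affine_group" and F: "\<And>p. p \<in> Rt \<Longrightarrow> F (P p) = P (affine l p)"
    and Q: "Q Rt (affine l)"
    and subset: "\<And>U. Q Rt (affine l) \<Longrightarrow> U \<subseteq> Rt \<Longrightarrow> Q U (affine l)"
    and cong: "\<And>U s. Q U (affine l) \<Longrightarrow> (\<And>p. p \<in> U \<Longrightarrow> affine l p = s p) \<Longrightarrow> Q U s"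
  shows "locally_in_charts lam \<phi> Q F"
  unfolding locally_in_charts_def
proof
  fix q assume "q \<in> Reeb lam \<phi>"
  then obtain p where p: "p \<in> Rt" "q = P p" by (rule Reeb_cases)
  obtain U0 where U0: "Reeb_chart lam \<phi> U0" "p \<in> U0"
    using ex_Reeb_chart[OF p(1)] by blast
  obtain V where V: "Reeb_chart lam \<phi> V" "affine l p \<in> V"
    using ex_Reeb_chart[OF affine_Rt[OF l p(1)]] by blast
  have U0_Rt: "U0 \<subseteq> Rt"
    using U0 openin_imp_subset unfolding Reeb_chart_def by blast
  define U where "U = {p \<in> U0. affine l p \<in> V}"
  have "openin (top_of_set Rt) U"
    unfolding U_def
  proof (rule openin_Rt_preimage)
    show "continuous_on U0 (affine l)"
      by (rule continuous_on_subset[OF smooth_on_imp_continuous_on[OF affine_smooth[OF l]] U0_Rt])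
  qed (use U0 V U0_Rt affine_Rt[OF l] in \<open>auto simp: Reeb_chart_def\<close>)
  moreover have "inj_on P U"
    using U0 by (auto simp: U_def Reeb_chart_def intro: inj_on_subset)
  ultimately have chart: "Reeb_chart lam \<phi> U"
    by (simp add: Reeb_chart_def)
  have FU: "F (P p) = P (affine l p)" "affine l p \<in> V" if "p \<in> U" for p
    using that U0_Rt F[of p] by (auto simp: U_def)
  have "Q U (in_charts lam \<phi> V F)"
  proof (rule cong[OF subset[OF Q]])
    show "U \<subseteq> Rt" using U0_Rt by (auto simp: U_def)
    show "affine l p = in_charts lam \<phi> V F p" if "p \<in> U" for p
      using V FU[OF that] by (simp add: in_charts_def Reeb_chart_def)
  qed
  moreover have "F ` P ` U \<subseteq> P ` V" using FU by auto
  moreover have "q \<in> P ` U" using p U0 V by (auto simp: U_def)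
  ultimately show "\<exists>U V. Reeb_chart lam \<phi> U \<and> Reeb_chart lam \<phi> V \<and> q \<in> P ` U \<and>
      F ` P ` U \<subseteq> P ` V \<and> Q U (in_charts lam \<phi> V F)"
    using chart V(1) by blast
qed

lemma desc_Aut_Reeb:
  assumes l: "l \<in> carrier affine_group"
  shows "desc_affine l \<in> carrier (Aut_Reeb lam \<phi>)"
proof -
  have smooth: "locally_in_charts lam \<phi> smooth_on F"
    if "l \<in> carrier affine_group" "\<And>p. p \<in> Rt \<Longrightarrow> F (P p) = P (affine l p)" for F l
    using that affine_smooth[OF that(1)] smooth_on_subset smooth_on_cong
    by (rule descent_locally_in_charts)
  have "locally_in_charts lam \<phi> smooth_on (desc_affine l)"
    by (rule smooth[OF l]) (simp add: desc_P l)
  moreover have "locally_in_charts lam \<phi> smooth_on (inv_into (Reeb lam \<phi>) (desc_affine l))"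
    by (rule smooth[OF affine_group.inv_closed[OF l]]) (simp add: inv_into_desc l P_Reeb desc_P)
  moreover have "locally_in_charts lam \<phi> leafwise_holomorphic_on (desc_affine l)"
  proof (rule descent_locally_in_charts[OF l])
    show "leafwise_holomorphic_on Rt (affine l)" by (rule affine_leafwise[OF l])
    show "leafwise_holomorphic_on U (affine l)" if "leafwise_holomorphic_on Rt (affine l)" "U \<subseteq> Rt" for U
      unfolding leafwise_holomorphic_on_def
    proof (intro allI conjI)
      fix x
      show "\<exists>y. \<forall>z. (z, x) \<in> U \<longrightarrow> snd (affine l (z, x)) = y"
        using that unfolding leafwise_holomorphic_on_def by (meson subsetD)
      show "(\<lambda>z. fst (affine l (z, x))) holomorphic_on {z. (z, x) \<in> U}"
        by (rule holomorphic_on_subset[of _ "{z. (z, x) \<in> Rt}"])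
          (use that in \<open>auto simp: leafwise_holomorphic_on_def\<close>)
    qed
    show "leafwise_holomorphic_on U s"
      if "leafwise_holomorphic_on U (affine l)" "\<And>p. p \<in> U \<Longrightarrow> affine l p = s p" for U s
      unfolding leafwise_holomorphic_on_def
    proof (intro allI conjI)
      fix x
      show "\<exists>y. \<forall>z. (z, x) \<in> U \<longrightarrow> snd (s (z, x)) = y"
        using that unfolding leafwise_holomorphic_on_def by metis
      show "(\<lambda>z. fst (s (z, x))) holomorphic_on {z. (z, x) \<in> U}"
        by (rule holomorphic_transform[of "\<lambda>z. fst (affine l (z, x))"])
          (use that in \<open>auto simp: leafwise_holomorphic_on_def\<close>)
    qed
  qed (simp add: desc_P l)
  moreover have "desc_affine l ` S \<in> leaves_Reeb lam \<phi>" if S: "S \<in> leaves_Reeb lam \<phi>" for S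
  proof -
    obtain x where x: "0 \<le> x" "S = P ` leaf x" using S by (auto simp: leaves_Reeb_iff)
    have "desc_affine l ` S = P ` affine l ` leaf x"
      unfolding x(2) image_image using leaf_Rt[OF x(1)] desc_P[OF l] by (intro image_cong) auto
    moreover have "affine l ` leaf x \<in> leaves_Rt"
      using affine_leaves[OF l] x by (auto simp: leaves_Rt_def)
    ultimately show ?thesis by (auto simp: leaves_Reeb_def)
  qed
  ultimately show ?thesis
    using desc_Bij[OF l] by (simp add: Aut_Reeb_def)
qed

lemma Aut_Reeb_carrier: "carrier (Aut_Reeb lam \<phi>) = desc_affine ` carrier affine_group"
proof
  show "desc_affine ` carrier affine_group \<subseteq> carrier (Aut_Reeb lam \<phi>)"
    using desc_Aut_Reeb by blast
  show "carrier (Aut_Reeb lam \<phi>) \<subseteq> desc_affine ` carrier affine_group"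
  proof
    fix F assume F: "F \<in> carrier (Aut_Reeb lam \<phi>)"
    then obtain l where l: "l \<in> carrier affine_group" "\<And>p. p \<in> Rt \<Longrightarrow> P (affine l p) = F (P p)"
      by (rule ex_equivariant_lift) blast
    have "F = desc_affine l"
    proof (rule extensionalityI)
      show "F \<in> extensional (Reeb lam \<phi>)"
        using F by (simp add: Aut_Reeb_def Bij_def)
      show "F q = desc_affine l q" if "q \<in> Reeb lam \<phi>" for q
        using that by (elim Reeb_cases) (simp add: desc_P l)
    qed (simp add: desc_def)
    with l show "F \<in> desc_affine ` carrier affine_group" by blast
  qed
qed

lemma Aut_Reeb_alt:
  "Aut_Reeb lam \<phi> = BijGroup (Reeb lam \<phi>)\<lparr>carrier := desc_affine ` carrier affine_group\<rparr>"
  unfolding Aut_Reeb_carrier[symmetric] by (simp add: Aut_Reeb_def)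

lemma desc_mult:
  assumes "l \<in> carrier affine_group" "l' \<in> carrier affine_group"
  shows "desc_affine (l \<otimes>\<^bsub>affine_group\<^esub> l') = desc_affine l \<otimes>\<^bsub>BijGroup (Reeb lam \<phi>)\<^esub> desc_affine l'"
  unfolding BijGroup_simps(3)[OF assms[THEN desc_Bij]]
proof (subst desc_restrict, rule restrict_ext)
  fix q assume "q \<in> Reeb lam \<phi>"
  then show "desc_affine (l \<otimes>\<^bsub>affine_group\<^esub> l') q = desc_affine l (desc_affine l' q)"
    using assms by (elim Reeb_cases) (simp add: desc_P affine_mult affine_Rt)
qed

lemma Aut_Reeb_group: "group (Aut_Reeb lam \<phi>)"
proof -
  have "group_hom affine_group (BijGroup (Reeb lam \<phi>)) desc_affine"
    using group_affine_group group_BijGroup desc_Bij desc_mult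
    by (auto simp: group_hom_def group_hom_axioms_def hom_def BijGroup_simps)
  then show ?thesis
    unfolding Aut_Reeb_alt
    by (rule group.subgroup_imp_group[OF group_BijGroup group_hom.img_is_subgroup])
qed

lemma Aut_Reeb_mult: "mult (Aut_Reeb lam \<phi>) = mult (BijGroup (Reeb lam \<phi>))"
  by (simp add: Aut_Reeb_def)

lemma desc_affine_hom: "group_hom affine_group (Aut_Reeb lam \<phi>) desc_affine"
  using group_affine_group Aut_Reeb_group desc_mult
  by (auto simp: group_hom_def group_hom_axioms_def hom_def Aut_Reeb_carrier Aut_Reeb_mult)

lemma desc_hom: "group_hom C (Aut_Reeb lam \<phi>) desc"
proof -
  have "desc (F \<otimes>\<^bsub>C\<^esub> F') = desc F \<otimes>\<^bsub>Aut_Reeb lam \<phi>\<^esub> desc F'"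
    if F: "F \<in> carrier C" "F' \<in> carrier C" for F F'
  proof -
    obtain l l' where l: "l \<in> carrier affine_group" "l' \<in> carrier affine_group" "F = affine l" "F' = affine l'"
      using F unfolding C_eq by auto
    have "F \<otimes>\<^bsub>C\<^esub> F' = affine (l \<otimes>\<^bsub>affine_group\<^esub> l')"
      unfolding C_eq using hom_mult[OF affine_hom l(1,2)] by (simp add: l)
    then show ?thesis
      using l by (simp add: desc_mult Aut_Reeb_mult)
  qed
  moreover have "desc F \<in> carrier (Aut_Reeb lam \<phi>)" if "F \<in> carrier C" for F
    using that unfolding C_eq Aut_Reeb_carrier by auto
  ultimately show ?thesis
    using C_group Aut_Reeb_group by (simp add: group_hom_def group_hom_axioms_def hom_def)
qed

text \<open>
  A map that preserves every orbit is a lift of the identity of the Reeb component.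
\<close>
lemma desc_affine_eq_one_iff:
  assumes l: "l \<in> carrier affine_group"
  shows "desc_affine l = \<one>\<^bsub>Aut_Reeb lam \<phi>\<^esub> \<longleftrightarrow> l \<in> range deck_param"
proof
  have one: "\<one>\<^bsub>Aut_Reeb lam \<phi>\<^esub> = (\<lambda>q\<in>Reeb lam \<phi>. q)"
    by (simp add: Aut_Reeb_def BijGroup_def)
  show "l \<in> range deck_param" if "desc_affine l = \<one>\<^bsub>Aut_Reeb lam \<phi>\<^esub>"
  proof -
    have "P (affine l p) = P p" if p: "p \<in> Rt" for p
      using desc_P[OF l p] P_Reeb[OF p] \<open>desc_affine l = _\<close> unfolding one by simp
    then have "\<exists>n. \<forall>p\<in>Rt. affine l p = deck n p"
      using smooth_on_imp_continuous_on[OF affine_smooth[OF l]] affine_Rt[OF l]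
      by (intro lifts_differ_by_deck[where g = "\<lambda>p. p"]) (auto intro: continuous_on_id)
    then obtain n where "\<And>p. p \<in> Rt \<Longrightarrow> affine l p = deck n p" by blast
    then have "affine l = affine (deck_param n)"
      unfolding affine_deck_param by (subst affine_restrict) (rule restrict_ext)
    then show ?thesis
      using affine_inj[OF l deck_param_closed] by blast
  qed
  show "desc_affine l = \<one>\<^bsub>Aut_Reeb lam \<phi>\<^esub>" if "l \<in> range deck_param"
  proof -
    from that obtain n where n: "l = deck_param n" by (rule rangeE)
    have "desc_affine l q = q" if "q \<in> Reeb lam \<phi>" for q
      using that by (elim Reeb_cases) (simp add: desc_P[OF l], simp add: n affine_deck_param)
    then show ?thesis
      unfolding one by (subst desc_restrict) (rule restrict_ext)
  qed
qed

lemma kernel_desc_affine: "kernel affine_group (Aut_Reeb lam \<phi>) desc_affine = range deck_param"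
proof (intro subset_antisym subsetI)
  show "l \<in> range deck_param" if "l \<in> kernel affine_group (Aut_Reeb lam \<phi>) desc_affine" for l
    using that desc_affine_eq_one_iff[of l] by (simp add: kernel_def)
  show "l \<in> kernel affine_group (Aut_Reeb lam \<phi>) desc_affine" if "l \<in> range deck_param" for l
  proof -
    have "l \<in> carrier affine_group" using that deck_param_closed by blast
    then show ?thesis using that desc_affine_eq_one_iff[of l] by (simp add: kernel_def)
  qed
qed

lemma kernel_desc: "kernel C (Aut_Reeb lam \<phi>) desc = generate C {hopf lam \<phi>}"
proof -
  have "kernel C (Aut_Reeb lam \<phi>) desc = affine ` kernel affine_group (Aut_Reeb lam \<phi>) desc_affine"
    by (auto simp: kernel_def C_eq simp del: split_paired_All split_paired_Ex)
  then have "kernel C (Aut_Reeb lam \<phi>) desc = affine ` range deck_param"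
    by (simp only: kernel_desc_affine)
  then show ?thesis
    by (simp add: C_generate affine_deck_param image_image)
qed

theorem Aut_Reeb_iso_centralizer: "Aut_Reeb lam \<phi> \<cong> C Mod generate C {hopf lam \<phi>}"
proof (rule iso_sym_of_quotient[OF desc_hom _ kernel_desc])
  show "desc ` carrier C = carrier (Aut_Reeb lam \<phi>)"
    by (simp add: C_eq Aut_Reeb_carrier image_image)
qed

subsection \<open>The semi-direct product\<close>

abbreviation N where "N \<equiv> generate scalings {(lam, \<phi>)}"

lemma N_eq: "N = range (\<lambda>n. (lam powi n, phi_pow n))"
proof -
  have "(lam powi (m + n), phi_pow (m + n)) = (lam powi m, phi_pow m) \<otimes>\<^bsub>scalings\<^esub> (lam powi n, phi_pow n)" for m n
  proof -
    have "phi_pow (m + n) = phi_pow m \<otimes>\<^bsub>Z\<^esub> phi_pow n"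
      unfolding Z_simps(2)[OF phi_pow_Z phi_pow_Z]
    proof (rule extensionalityI)
      show "phi_pow (m + n) \<in> extensional {0..}"
        by (rule Bij_imp_extensional[OF Z_Bij[OF phi_pow_Z]])
    qed (simp_all add: phi_pow_add)
    then show ?thesis
      by (simp add: Cstar_def power_int_add)
  qed
  moreover have "(lam powi n, phi_pow n) \<in> carrier scalings" for n
    unfolding scalings_iff by (simp add: phi_pow_Z)
  ultimately show ?thesis
    using group.generate_one_parameter[OF group_scalings, of "\<lambda>n. (lam powi n, phi_pow n)"] by simp
qed

lemma N_normal: "N \<lhd> scalings"
proof (rule group.generate_central_normal[OF group_scalings])
  show "(lam, \<phi>) \<in> carrier scalings" by (simp add: phi_Z Cstar_def)
  show "h \<otimes>\<^bsub>scalings\<^esub> (lam, \<phi>) = (lam, \<phi>) \<otimes>\<^bsub>scalings\<^esub> h" if "h \<in> carrier scalings" for h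
    using that phi_Z by (cases h) (auto simp: Cstar_def Z_simps Z_commute)
qed

lemma K_phi_pow:
  assumes "b \<in> carrier K" "0 \<le> x"
  shows "b (phi_pow n x) = lam powi n * b x"
proof (induction n rule: int_induct[where k = 0])
  case base
  then show ?case using assms by simp
next
  case (step1 i)
  have "b (phi_pow (i + 1) x) = b (\<phi> (phi_pow i x))"
    using phi_pow_add[OF assms(2), of 1 i] by (simp add: add.commute)
  then show ?case
    using step1 assms by (simp add: K_iff power_int_add)
next
  case (step2 i)
  have "b (phi_pow i x) = lam * b (phi_pow (i - 1) x)"
    using phi_pow_add[OF assms(2), of 1 "i - 1"] assms by (simp add: K_iff)
  then show ?case
    using step2 by (simp add: power_int_diff field_simps)
qed

text \<open>
  The representatives of the coset of \<open>(a, \<eta>)\<close> are \<open>(lam\<^sup>n * a, \<phi>\<^sup>n \<circ> \<eta>)\<close>, and the factor \<open>lam\<^sup>n\<close>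
  cancels against \<open>b \<circ> \<phi>\<^sup>n = lam\<^sup>n * b\<close>.
\<close>
lemma Kact_coset:
  assumes h: "h \<in> carrier scalings" and b: "b \<in> carrier K"
  shows "Kact (N #>\<^bsub>scalings\<^esub> h) b = scaling_act h b"
proof -
  obtain a \<eta> where h1: "h = (a, \<eta>)" by (cases h)
  have a: "a \<noteq> 0" and eta: "\<eta> \<in> carrier Z" using h by (auto simp: h1 Cstar_def)
  have coset: "N #>\<^bsub>scalings\<^esub> h = range (\<lambda>n. (lam powi n * a, \<lambda>x\<in>{0..}. phi_pow n (\<eta> x)))"
  proof -
    have "N #>\<^bsub>scalings\<^esub> h = (\<lambda>m. m \<otimes>\<^bsub>scalings\<^esub> h) ` range (\<lambda>n. (lam powi n, phi_pow n))"
      unfolding N_eq r_coset_def by blast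
    also have "\<dots> = range (\<lambda>n. (lam powi n, phi_pow n) \<otimes>\<^bsub>scalings\<^esub> (a, \<eta>))"
      by (simp only: image_image h1)
    finally show ?thesis
      using eta phi_pow_Z by (simp add: Cstar_def Z_simps)
  qed
  have "(\<lambda>x\<in>{0..}. inverse (lam powi n * a) * b ((\<lambda>x\<in>{0..}. phi_pow n (\<eta> x)) x)) = scaling_act h b" for n
    using a by (auto simp: h1 scaling_act_def K_phi_pow[OF b Z_nonneg[OF eta]])
  then have "(\<forall>(a, \<eta>)\<in>N #>\<^bsub>scalings\<^esub> h. c = (\<lambda>x\<in>{0..}. inverse a * b (\<eta> x))) \<longleftrightarrow> c = scaling_act h b" for c
    unfolding coset by auto
  then show ?thesis
    by (simp add: Kact_def)
qed

lemma Hgroup_eq: "Hgroup lam \<phi> = scalings Mod N"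
  by (simp add: Hgroup_def Let_def)

theorem Aut_Reeb_iso_semidirect: "Aut_Reeb lam \<phi> \<cong> semidirect K (Hgroup lam \<phi>) Kact"
proof -
  note q = affine_group.semidirect_quotient[where act' = Kact, OF N_normal Kact_coset, folded Hgroup_eq affine_group_def]
  have "{\<one>\<^bsub>K\<^esub>} \<times> N = range deck_param"
    by (auto simp: N_eq deck_param_def K_simps)
  then have "affine_group Mod range deck_param \<cong> semidirect K (Hgroup lam \<phi>) Kact"
    using group_hom.FactGroup_iso[OF q(1,2)] q(3) by simp
  moreover have "Aut_Reeb lam \<phi> \<cong> affine_group Mod range deck_param"
    by (rule iso_sym_of_quotient[OF desc_affine_hom _ kernel_desc_affine]) (simp add: Aut_Reeb_carrier)
  ultimately show ?thesis
    by (rule iso_trans[rotated])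
qed

end

theorem theorem3p9:
  fixes lam :: complex and \<phi> :: "real \<Rightarrow> real"
  assumes "norm lam > 1"
    and "\<phi> \<in> carrier Diff_half"
    and "expanding \<phi>"
  shows "Aut_Reeb lam \<phi> \<cong>
           centralizer_of Aut_Rt (hopf lam \<phi>) Mod
             generate (centralizer_of Aut_Rt (hopf lam \<phi>)) {hopf lam \<phi>}
         \<and> Aut_Reeb lam \<phi> \<cong> semidirect (Kgroup lam \<phi>) (Hgroup lam \<phi>) Kact"
proof -
  interpret hopf_construction lam \<phi>
    using assms by unfold_locales
  show ?thesis
    using Aut_Reeb_iso_centralizer Aut_Reeb_iso_semidirect by blast
qed

end
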